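(* Let $A$ be any $2n\times 2n$ real positive definite matrix. Then $\Delta_c(A)\prec^w d_s(A)$. Conversely, if $x=(x_1,\ldots,x_n)$ and $y=(y_1,\ldots,y_n)$ are vectors with all entries positive such that $x\prec^w y$, then there exists a $2n\times 2n$ real positive definite matrix $A$ such that $\Delta_c(A)=x$ and the symplectic eigenvalues of $A$, counted with multiplicity, are $y_1,\ldots,y_n$ (i.e. $d_s(A)$ is the increasing rearrangement of $y$).
   Context: Let $J=\begin{bmatrix}0 & I_n\\ -I_n & 0\end{bmatrix}$ and $Sp(2n)=\{M\in\mathbb{R}^{2n\times 2n}: M^TJM=J\}$. By Williamson's theorem, for every $2n\times 2n$ real positive definite matrix $A$ there is $M\in Sp(2n)$ with $M^TAM=\begin{bmatrix}D&0\\0&D\end{bmatrix}$, $D$ a positive diagonal $n\times n$ matrix; its diagonal entries, uniquely determined by $A$ and listed as $d_1(A)\le\cdots\le d_n(A)$, are the symplectic eigenvalues of $A$. Write $d_s(A)=(d_1(A),\ldots,d_n(A))$. For $A=(a_{ij})$ a $2n\times 2n$ real positive definite matrix, define $\Delta_c(A)\in\mathbb{R}^n$ by $\Delta_c(A)_j=\tfrac12\left(a_{jj}+a_{n+j,n+j}\right)$, $1\le j\le n$ (the entrywise arithmetic mean of the diagonals of the two diagonal $n\times n$ blocks of $A$). For $x\in\mathbb{R}^n$ let $x_1^{\uparrow}\le\cdots\le x_n^{\uparrow}$ denote its entries in increasing order. For $x,y\in\mathbb{R}^n$, $x\prec^w y$ (weak supermajorisation) means $\sum_{j=1}^k x_j^{\uparrow}\ge\sum_{j=1}^k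 y_j^{\uparrow}$ for all $1\le k\le n$. *)

theory Defs
  imports "Jordan_Normal_Form.Matrix"
begin

definition J_mat :: "nat \<Rightarrow> real mat" where
  "J_mat n = four_block_mat (0\<^sub>m n n) (1\<^sub>m n) (- 1\<^sub>m n) (0\<^sub>m n n)"

definition symplectic :: "nat \<Rightarrow> real mat \<Rightarrow> bool" where
  "symplectic n M \<longleftrightarrow> M \<in> carrier_mat (2*n) (2*n) \<and>
      transpose_mat M * J_mat n * M = J_mat n"

definition pos_def :: "nat \<Rightarrow> real mat \<Rightarrow> bool" where
  "pos_def m A \<longleftrightarrow> A \<in> carrier_mat m m \<and> transpose_mat A = A \<and>
      (\<forall>v \<in> carrier_vec m. v \<noteq> 0\<^sub>v m \<longrightarrow> v \<bullet> (A *\<^sub>v v) > 0)"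

definition diag_of_list :: "real list \<Rightarrow> real mat" where
  "diag_of_list d = mat (length d) (length d) (\<lambda>(i,j). if i = j then d ! i else 0)"

definition williamson :: "nat \<Rightarrow> real mat \<Rightarrow> real list \<Rightarrow> bool" where
  "williamson n A d \<longleftrightarrow> length d = n \<and> (\<forall>x \<in> set d. x > 0) \<and>
     (\<exists>M. symplectic n M \<and>
        transpose_mat M * A * M = four_block_mat (diag_of_list d) (0\<^sub>m n n) (0\<^sub>m n n) (diag_of_list d))"

definition sympl_eigvals :: "nat \<Rightarrow> real mat \<Rightarrow> real list" where
  "sympl_eigvals n A = (THE d. sorted d \<and> williamson n A d)"

definition Delta_c :: "nat \<Rightarrow> real mat \<Rightarrow> real list" where
  "Delta_c n A = map (\<lambda>j. (A $$ (j, j) + A $$ (n + j, n + j)) / 2) [0..<n]"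

definition weak_supmaj :: "real list \<Rightarrow> real list \<Rightarrow> bool" where
  "weak_supmaj x y \<longleftrightarrow> length x = length y \<and>
     (\<forall>k \<in> {1..length x}. sum_list (take k (sort x)) \<ge> sum_list (take k (sort y)))"

end

theory Submission
  imports
    "HOL-Analysis.Function_Topology"
    "HOL-Combinatorics.List_Permutation"
    "Jordan_Normal_Form.Determinant"
    Defs
begin

text \<open>
  Write \<open>A = S\<^sup>T (D \<oplus> D) S\<close> with \<open>S\<close> symplectic and let \<open>P\<close> be the complex-linear part of
  \<open>S\<close>. Then \<open>P\<close> expands the norm, and so does its restriction to the coordinates \<open>j, n + j\<close>
  for \<open>j\<close> in a set of size \<open>k\<close>; the orthogonal projection onto the range of the restriction
  has trace \<open>2k\<close> and diagonal entries at most \<open>1\<close> that are dominated by the squared row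
  norms. Hence any \<open>k\<close> entries of \<open>\<Delta>\<^sub>c(A)\<close> sum to at least \<open>d\<^sub>1 + \<dots> + d\<^sub>k\<close>. Applied to
  \<open>A = D' \<oplus> D'\<close> this also shows that the normal form is unique.

  The normal form exists because a weighted trace with distinct positive weights attains its
  minimum over the symplectic congruences of \<open>A\<close>; stationarity along symplectic transvections forces
  the minimiser to be of the form \<open>D \<oplus> D\<close>.

  For the converse start with \<open>D \<oplus> D\<close>. Rotating the planes \<open>(i, l)\<close> and \<open>(n + i, n + l)\<close>
  simultaneously moves mass between the entries \<open>i\<close> and \<open>l\<close> of \<open>\<Delta>\<^sub>c\<close> (a T-transform), and
  squeezing by \<open>t\<close> and \<open>1/t\<close> in the plane \<open>(i, n + i)\<close> raises entry \<open>i\<close>. These two moves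
  generate weak supermajorisation.\<close>

section \<open>Symplectic and positive definite matrices\<close>

lemma congruence_carrier:
  assumes "A \<in> carrier_mat m m" "M \<in> carrier_mat m r"
  shows "transpose_mat M * A * M \<in> carrier_mat r r"
  using assms by auto

lemma congruence_index:
  fixes A M :: "'a::comm_semiring_1 mat"
  assumes A: "A \<in> carrier_mat m m" and M: "M \<in> carrier_mat m r" and "a < r" "b < r"
  shows "(transpose_mat M * A * M) $$ (a, b) = (\<Sum>c<m. \<Sum>d<m. M $$ (c, a) * A $$ (c, d) * M $$ (d, b))"
proof -
  have "transpose_mat M * A * M = transpose_mat M * (A * M)"
    using A M by (intro assoc_mult_mat) auto
  thus ?thesis
    using assms by (simp add: scalar_prod_def atLeast0LessThan sum_distrib_left mult.assoc)
qed

lemma congruence_assoc: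
  assumes "A \<in> carrier_mat m m" "M \<in> carrier_mat m m" "N \<in> carrier_mat m (r::nat)"
  shows "transpose_mat (M * N) * A * (M * N) = transpose_mat N * (transpose_mat M * A * M) * (N :: 'a::comm_ring_1 mat)"
proof -
  have "transpose_mat (M * N) * A * (M * N) = transpose_mat N * transpose_mat M * A * M * N"
    using assms by (simp add: transpose_mult[of _ m m _ r] assoc_mult_mat[of _ r m _ m _ r, symmetric])
  also have "\<dots> = transpose_mat N * (transpose_mat M * A * M) * N"
    using assms by (simp add: assoc_mult_mat[of _ r m _ m _ m])
  finally show ?thesis .
qed

lemma mult_mat_zero_vec:
  fixes A :: "'a::comm_ring_1 mat"
  shows "A \<in> carrier_mat m r \<Longrightarrow> A *\<^sub>v 0\<^sub>v r = 0\<^sub>v m"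
  by (intro eq_vecI) auto

lemma mult_mat_unit_vec:
  fixes A :: "'a::comm_ring_1 mat"
  shows "A \<in> carrier_mat m r \<Longrightarrow> i < r \<Longrightarrow> A *\<^sub>v unit_vec r i = col A i"
  by (intro eq_vecI) auto

lemma scalar_prod_mult_mat_vec:
  fixes X :: "'a::comm_ring_1 mat"
  assumes "X \<in> carrier_mat m r" "v \<in> carrier_vec r" "u \<in> carrier_vec m"
  shows "u \<bullet> (X *\<^sub>v v) = (transpose_mat X *\<^sub>v u) \<bullet> v"
  using assms transpose_vec_mult_scalar[of X m r v u] comm_scalar_prod[of u m]
    comm_scalar_prod[of v r] by auto

lemma congruence_scalar_prod:
  fixes A M :: "'a::comm_ring_1 mat"
  assumes "A \<in> carrier_mat m m" "M \<in> carrier_mat m r" "u \<in> carrier_vec r" "v \<in> carrier_vec r"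
  shows "u \<bullet> ((transpose_mat M * A * M) *\<^sub>v v) = (M *\<^sub>v u) \<bullet> (A *\<^sub>v (M *\<^sub>v v))"
proof -
  have "(transpose_mat M * A * M) *\<^sub>v v = transpose_mat M *\<^sub>v (A *\<^sub>v (M *\<^sub>v v))"
    using assms by (simp add: assoc_mult_mat_vec[of _ r m _ r] assoc_mult_mat_vec[of _ r m _ m])
  thus ?thesis using assms by (simp add: scalar_prod_mult_mat_vec[of _ r m])
qed

lemma J_mat_carrier [simp]: "J_mat n \<in> carrier_mat (2*n) (2*n)"
  "dim_row (J_mat n) = 2 * n" "dim_col (J_mat n) = 2 * n"
  unfolding J_mat_def by (auto simp: mult_2)

lemma J_mat_mult_vec_carrier [simp]:
  "w \<in> carrier_vec (2*n) \<Longrightarrow> J_mat n *\<^sub>v w \<in> carrier_vec (2*n)"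
  by (rule mult_mat_vec_carrier[OF J_mat_carrier(1)])

lemma J_mat_index [simp]:
  assumes "a < 2*n" "b < 2*n"
  shows "J_mat n $$ (a, b) = (if b = a + n then 1 else if a = b + n then -1 else 0)"
  using assms unfolding J_mat_def by (auto simp: one_mat_def)

lemma transpose_J_mat: "transpose_mat (J_mat n) = - J_mat n"
  by (rule eq_matI) auto

lemma J_mat_square: "J_mat n * J_mat n = - 1\<^sub>m (2*n)"
proof (rule eq_matI)
  fix a b assume "a < dim_row (- 1\<^sub>m (2*n) :: real mat)" "b < dim_col (- 1\<^sub>m (2*n) :: real mat)"
  hence ab: "a < 2*n" "b < 2*n" by auto
  have "(J_mat n * J_mat n) $$ (a, b) = (\<Sum>c<2*n. J_mat n $$ (a, c) * J_mat n $$ (c, b))"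
    using ab by (simp add: scalar_prod_def atLeast0LessThan del: J_mat_index)
  also have "\<dots> = (\<Sum>c<2*n. if c = (if a < n then a + n else a - n) then (if a = b then - 1 else 0) else 0)"
    using ab by (intro sum.cong) auto
  also have "\<dots> = (if a = b then - 1 else 0)"
    using ab by (subst sum.delta) auto
  finally show "(J_mat n * J_mat n) $$ (a, b) = (- 1\<^sub>m (2*n)) $$ (a, b)"
    using ab by auto
qed auto

lemma symplecticD:
  assumes "symplectic n M"
  shows "M \<in> carrier_mat (2*n) (2*n)" "transpose_mat M * J_mat n * M = J_mat n"
  using assms unfolding symplectic_def by auto

lemma symplectic_one: "symplectic n (1\<^sub>m (2*n))"
  unfolding symplectic_def by (simp add: left_mult_one_mat[OF J_mat_carrier(1)] right_mult_one_mat[OF J_mat_carrier(1)])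

lemma symplectic_mult:
  assumes "symplectic n S" "symplectic n T"
  shows "symplectic n (S * T)"
  using symplecticD[OF assms(1)] symplecticD[OF assms(2)] congruence_assoc[of "J_mat n" "2*n" S T "2*n"]
  unfolding symplectic_def by auto

text \<open>From \<open>S^T J S = J\<close> and \<open>J^2 = -1\<close> the inverse is
  \<open>-J S^T J\<close>. It is symplectic because pulling \<open>J\<close> back along
  \<open>S * N = 1\<close> returns \<open>J\<close>.\<close>

lemma symplectic_inverse:
  assumes S: "symplectic n S"
  obtains N where "symplectic n N" "N * S = 1\<^sub>m (2*n)" "S * N = 1\<^sub>m (2*n)"
proof -
  note c = symplecticD(1)[OF S]
  define N where "N = (- J_mat n) * (transpose_mat S * J_mat n)"
  have N: "N \<in> carrier_mat (2*n) (2*n)" unfolding N_def using c by auto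
  have "N * S = (- J_mat n) * (transpose_mat S * J_mat n * S)"
    unfolding N_def using c by (intro assoc_mult_mat) auto
  also have "\<dots> = - (J_mat n * J_mat n)"
    using symplecticD(2)[OF S] by (metis uminus_mult_left_mat J_mat_carrier(2,3))
  also have "\<dots> = 1\<^sub>m (2*n)"
    by (simp add: J_mat_square)
  finally have NS: "N * S = 1\<^sub>m (2*n)" .
  have SN: "S * N = 1\<^sub>m (2*n)"
    using mat_mult_left_right_inverse[OF N c NS] .
  have "transpose_mat N * J_mat n * N = transpose_mat (S * N) * J_mat n * (S * N)"
    using congruence_assoc[of "J_mat n" "2*n" S N "2*n"] c N symplecticD(2)[OF S] by auto
  also have "\<dots> = J_mat n"
    using symplectic_one[of n] unfolding SN symplectic_def by auto
  finally show thesis using that N NS SN unfolding symplectic_def by auto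
qed

lemma pos_defD:
  assumes "pos_def m A"
  shows "A \<in> carrier_mat m m" "transpose_mat A = A"
    "\<And>v. v \<in> carrier_vec m \<Longrightarrow> v \<noteq> 0\<^sub>v m \<Longrightarrow> v \<bullet> (A *\<^sub>v v) > 0"
  using assms unfolding pos_def_def by auto

lemma pos_def_symmetric:
  assumes "pos_def m A" "a < m" "b < m"
  shows "A $$ (a, b) = A $$ (b, a)"
  using pos_defD(1,2)[OF assms(1)] assms(2,3) by (metis carrier_matD index_transpose_mat(1))

lemma pos_def_congruence:
  assumes A: "pos_def (2*n) A" and S: "symplectic n S"
  shows "pos_def (2*n) (transpose_mat S * A * S)"
proof -
  note cA = pos_defD[OF A] and cS = symplecticD(1)[OF S]
  obtain N where N: "symplectic n N" "N * S = 1\<^sub>m (2*n)" using symplectic_inverse[OF S] .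
  have "transpose_mat (transpose_mat S * A * S) = transpose_mat S * A * S"
    using cA(1,2) cS by (simp add: transpose_mult[of _ "2*n" "2*n" _ "2*n"] assoc_mult_mat[of _ "2*n" "2*n" _ "2*n" _ "2*n"])
  moreover have "v \<bullet> (transpose_mat S * A * S *\<^sub>v v) > 0" if v: "v \<in> carrier_vec (2*n)" "v \<noteq> 0\<^sub>v (2*n)" for v
  proof -
    have "S *\<^sub>v v \<noteq> 0\<^sub>v (2*n)"
    proof
      assume "S *\<^sub>v v = 0\<^sub>v (2*n)"
      hence "(N * S) *\<^sub>v v = 0\<^sub>v (2*n)"
        using symplecticD(1)[OF N(1)] cS v by (simp add: mult_mat_zero_vec assoc_mult_mat_vec[of _ "2*n" "2*n" _ "2*n"])
      thus False using N(2) v by simp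
    qed
    thus ?thesis using congruence_scalar_prod[of A "2*n" S "2*n" v v] cA cS v by auto
  qed
  ultimately show ?thesis using cA cS unfolding pos_def_def by auto
qed

lemma pos_def_diag:
  assumes A: "pos_def m A" and i: "i < m"
  shows "A $$ (i, i) > 0"
proof -
  have "unit_vec m i \<bullet> (A *\<^sub>v unit_vec m i) = A $$ (i, i)"
    using pos_defD(1)[OF A] i by (simp add: mult_mat_unit_vec)
  moreover have "unit_vec m i \<noteq> (0\<^sub>v m :: real vec)"
    using i by (metis index_unit_vec(1) index_zero_vec(1) zero_neq_one)
  ultimately show ?thesis using pos_defD(3)[OF A, of "unit_vec m i"] by simp
qed

lemma inverse_if_kernel_trivial:
  fixes G :: "real mat"
  assumes G: "G \<in> carrier_mat m m" and ker: "\<And>v. v \<in> carrier_vec m \<Longrightarrow> G *\<^sub>v v = 0\<^sub>v m \<Longrightarrow> v = 0\<^sub>v m"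
  obtains H where "H \<in> carrier_mat m m" "G * H = 1\<^sub>m m" "H * G = 1\<^sub>m m"
proof -
  have "det G \<noteq> 0" using det_0_iff_vec_prod_zero_field[OF G] ker by auto
  from det_non_zero_imp_unit[OF G this, of "()"] obtain H where "H \<in> carrier_mat m m" "G * H = 1\<^sub>m m" "H * G = 1\<^sub>m m"
    unfolding Units_def by (auto simp: ring_mat_simps)
  thus thesis using that by auto
qed

section \<open>Row weights from an orthogonal projection\<close>

lemma scalar_prod_self_nonneg:
  "0 \<le> v \<bullet> (v :: real vec)"
  by (simp add: scalar_prod_def sum_nonneg)

lemma scalar_prod_self_eq_0:
  "v \<in> carrier_vec m \<Longrightarrow> v \<bullet> v = 0 \<longleftrightarrow> v = 0\<^sub>v (m :: nat)" for v :: "real vec"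
  by (auto simp: scalar_prod_def sum_nonneg_eq_0_iff)

lemma scalar_prod_diff_self:
  fixes u v :: "real vec"
  assumes "u \<in> carrier_vec m" "v \<in> carrier_vec m"
  shows "(u - v) \<bullet> (u - v) = u \<bullet> u - 2 * (u \<bullet> v) + v \<bullet> v"
  using assms by (simp add: scalar_prod_def sum_distrib_left algebra_simps flip: sum.distrib sum_subtractf)

text \<open>The weights are the diagonal entries of the orthogonal projection
  \<open>X (X\<^sup>T X)\<^sup>-\<^sup>1 X\<^sup>T\<close> onto the range of \<open>X\<close>.\<close>

lemma expanding_mat_row_weights:
  fixes X :: "real mat"
  assumes X: "X \<in> carrier_mat m r"
    and exp: "\<And>v. v \<in> carrier_vec r \<Longrightarrow> v \<bullet> v \<le> (X *\<^sub>v v) \<bullet> (X *\<^sub>v v)"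
  obtains c :: "nat \<Rightarrow> real" where
    "\<And>i. i < m \<Longrightarrow> 0 \<le> c i \<and> c i \<le> 1 \<and> c i \<le> row X i \<bullet> row X i" "(\<Sum>i<m. c i) = real r"
proof -
  define G where "G = transpose_mat X * X"
  have G: "G \<in> carrier_mat r r" unfolding G_def using X by auto
  have Gv: "G *\<^sub>v v = transpose_mat X *\<^sub>v (X *\<^sub>v v)" if "v \<in> carrier_vec r" for v
    unfolding G_def using X that by (intro assoc_mult_mat_vec) auto
  have quad: "v \<bullet> (G *\<^sub>v v) = (X *\<^sub>v v) \<bullet> (X *\<^sub>v v)" if "v \<in> carrier_vec r" for v
    using that X by (simp add: Gv scalar_prod_mult_mat_vec[of _ r m])
  obtain H where H: "H \<in> carrier_mat r r" "G * H = 1\<^sub>m r" "H * G = 1\<^sub>m r"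
  proof (rule inverse_if_kernel_trivial[OF G])
    fix v assume v: "v \<in> carrier_vec r" "G *\<^sub>v v = 0\<^sub>v r"
    hence "v \<bullet> v \<le> 0" using exp[of v] quad[of v] by simp
    thus "v = 0\<^sub>v r" using scalar_prod_self_nonneg[of v] scalar_prod_self_eq_0[of v r] v by simp
  qed
  define Pr where "Pr = X * H * transpose_mat X"
  have Pr: "Pr \<in> carrier_mat m m" unfolding Pr_def using X H by auto
  have HT: "transpose_mat H = H"
  proof -
    have "transpose_mat G = G" unfolding G_def using X by (simp add: transpose_mult[of _ r m _ r])
    hence "transpose_mat H * G = 1\<^sub>m r"
      using transpose_mult[OF G H(1)] H(2) by simp
    hence "transpose_mat H * G * H = H" using H by simp
    thus ?thesis using H G assoc_mult_mat[of "transpose_mat H" r r G r H r] by simp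
  qed
  have XTX: "transpose_mat X * (X * Y) = G * Y" if "Y \<in> carrier_mat r k" for Y k
    unfolding G_def using X that by (simp add: assoc_mult_mat[of _ r m _ r _ k])
  have sym: "transpose_mat Pr = Pr"
    unfolding Pr_def using X H HT
    by (simp add: transpose_mult[of _ m r _ m] transpose_mult[of _ r r _ m] transpose_mult[of _ m r _ r] assoc_mult_mat[of _ m r _ r _ m])
  have idem: "Pr * Pr = Pr"
  proof -
    have 1: "Pr = X * (H * transpose_mat X)"
      unfolding Pr_def using X H by (intro assoc_mult_mat) auto
    have "Pr * Pr = X * H * (transpose_mat X * (X * (H * transpose_mat X)))"
      using X H by (subst 1, subst Pr_def, intro assoc_mult_mat) auto
    also have "\<dots> = X * H * (G * (H * transpose_mat X))"
      using X H by (simp add: XTX[of _ m])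
    also have "G * (H * transpose_mat X) = transpose_mat X"
      using X H G assoc_mult_mat[OF G H(1), of "transpose_mat X" m] by simp
    finally show ?thesis unfolding Pr_def .
  qed
  define c where "c i = Pr $$ (i, i)" for i
  have c_sq: "c i = (\<Sum>j<m. (Pr $$ (i, j))\<^sup>2)" if i: "i < m" for i
  proof -
    have "c i = (transpose_mat Pr * Pr) $$ (i, i)" unfolding c_def sym idem ..
    also have "\<dots> = (\<Sum>j<m. (Pr $$ (j, i))\<^sup>2)"
      using i Pr by (simp add: scalar_prod_def atLeast0LessThan power2_eq_square)
    also have "\<dots> = (\<Sum>j<m. (Pr $$ (i, j))\<^sup>2)"
      using i Pr sym by (intro sum.cong) (auto, metis carrier_matD index_transpose_mat(1))
    finally show ?thesis .
  qed
  have "0 \<le> c i \<and> c i \<le> 1 \<and> c i \<le> row X i \<bullet> row X i" if i: "i < m" for i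
  proof (intro conjI)
    show "0 \<le> c i" unfolding c_sq[OF i] by (simp add: sum_nonneg)
    \<comment> \<open>Symmetry and idempotence make \<open>c i\<close> the sum of the squares of row
      \<open>i\<close> of \<open>Pr\<close>. One of these squares is that of the diagonal entry
      \<open>c i\<close> itself, which forces \<open>c i\<close> to be at most 1.\<close>
    have "(c i)\<^sup>2 \<le> c i" unfolding c_sq[OF i]
      using i member_le_sum[of i "{..<m}" "\<lambda>j. (Pr $$ (i, j))\<^sup>2"]
      by (simp add: c_def flip: c_sq[OF i])
    thus "c i \<le> 1" by (smt (verit) mult_le_cancel_right2 power2_eq_square)
    define x where "x = row X i"
    \<comment> \<open>\<open>g\<close> solves \<open>G g = x\<close>, so \<open>c i\<close> is the
      product x.g. Expansion gives |g|^2 <= g.Gg = x.g, and then 0 <= |x - g|^2 <= |x|^2 -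
      x.g.\<close>
    define g where "g = H *\<^sub>v x"
    have x: "x \<in> carrier_vec r" and g: "g \<in> carrier_vec r" unfolding x_def g_def using X H i by auto
    have Gg: "G *\<^sub>v g = x"
      unfolding g_def using assoc_mult_mat_vec[OF G H(1) x] H x by simp
    have xg: "x \<bullet> g = c i"
    proof -
      have "Pr = X * (H * transpose_mat X)"
        unfolding Pr_def using X H by (intro assoc_mult_mat) auto
      hence "c i = row X i \<bullet> col (H * transpose_mat X) i"
        unfolding c_def using i X H by simp
      also have "col (H * transpose_mat X) i = g"
        unfolding g_def x_def using i X H by (intro eq_vecI) auto
      finally show ?thesis unfolding x_def by simp
    qed
    have 1: "g \<bullet> g \<le> x \<bullet> g"
      using exp[OF g] quad[OF g] Gg comm_scalar_prod[OF x g] by simp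
    hence "x \<bullet> g \<le> x \<bullet> x"
      using scalar_prod_self_nonneg[of "x - g"] scalar_prod_diff_self[OF x g] by simp
    thus "c i \<le> row X i \<bullet> row X i" unfolding xg unfolding x_def .
  qed
  moreover have "(\<Sum>i<m. c i) = real r"
  proof -
    \<comment> \<open>The trace is cyclic: tr(X H X^T) = tr(X^T X H), and the latter matrix is the
      identity of size \<open>r\<close>.\<close>
    have "(\<Sum>i<m. c i) = (\<Sum>i<m. \<Sum>j<r. (X * H) $$ (i, j) * X $$ (i, j))"
      unfolding c_def Pr_def using X H by (intro sum.cong refl) (simp add: scalar_prod_def atLeast0LessThan del: assoc_mult_mat)
    also have "\<dots> = (\<Sum>j<r. \<Sum>i<m. X $$ (i, j) * (X * H) $$ (i, j))"
      by (subst sum.swap) (simp add: mult.commute)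
    also have "\<dots> = (\<Sum>j<r. (transpose_mat X * (X * H)) $$ (j, j))"
      using X H by (intro sum.cong refl) (simp add: scalar_prod_def atLeast0LessThan)
    also have "transpose_mat X * (X * H) = 1\<^sub>m r"
      using XTX[OF H(1)] H by simp
    finally show ?thesis by simp
  qed
  ultimately show thesis using that by blast
qed

text \<open>Compare \<open>e\<close> with the indicator of the first \<open>k\<close> indices. With
  the pivot \<open>p = d ! (k - 1)\<close> every product of \<open>d ! i - p\<close> and the
  difference of the two weights is nonnegative, and subtracting \<open>p\<close> changes nothing
  since both weights have total \<open>k\<close>.\<close>

lemma weighted_sum_ge_sum_smallest:
  fixes d :: "real list" and e :: "nat \<Rightarrow> real"
  assumes "sorted d" and e: "\<And>i. i < length d \<Longrightarrow> 0 \<le> e i \<and> e i \<le> 1"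
    and sum: "(\<Sum>i<length d. e i) = real k" and k: "1 \<le> k" "k \<le> length d"
  shows "(\<Sum>i<k. d ! i) \<le> (\<Sum>i<length d. d ! i * e i)"
proof -
  define p where "p = d ! (k - 1)"
  let ?n = "length d"
  let ?o = "\<lambda>i. if i < k then 1 else 0 :: real"
  have split: "(\<Sum>i<?n. f i * ?o i) = (\<Sum>i<k. f i)" for f :: "nat \<Rightarrow> real"
  proof -
    have "(\<Sum>i<?n. f i * ?o i) = (\<Sum>i<?n. if i \<in> {..<k} then f i else 0)"
      by (intro sum.cong) auto
    also have "\<dots> = (\<Sum>i\<in>{..<?n} \<inter> {..<k}. f i)" by (simp add: sum.inter_restrict)
    also have "{..<?n} \<inter> {..<k} = {..<k}" using k by auto
    finally show ?thesis .
  qed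
  have "0 \<le> (\<Sum>i<?n. (d ! i - p) * (e i - ?o i))"
  proof (intro sum_nonneg)
    fix i assume i: "i \<in> {..<?n}"
    show "0 \<le> (d ! i - p) * (e i - ?o i)"
    proof (cases "i < k")
      case True
      hence "d ! i \<le> p" unfolding p_def using sorted_nth_mono[OF \<open>sorted d\<close>, of i "k - 1"] k by simp
      thus ?thesis using e[of i] i True by (intro mult_nonpos_nonpos) auto
    next
      case False
      hence "d ! i \<ge> p" unfolding p_def using sorted_nth_mono[OF \<open>sorted d\<close>, of "k - 1" i] i by simp
      thus ?thesis using e[of i] i False by (intro mult_nonneg_nonneg) auto
    qed
  qed
  also have "\<dots> = (\<Sum>i<?n. d ! i * e i) - (\<Sum>i<?n. d ! i * ?o i) - p * ((\<Sum>i<?n. e i) - (\<Sum>i<?n. 1 * ?o i))"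
    unfolding sum_distrib_left sum_subtractf[symmetric] by (intro sum.cong) (auto simp: algebra_simps)
  also have "\<dots> = (\<Sum>i<?n. d ! i * e i) - (\<Sum>i<k. d ! i)"
    unfolding split[of "\<lambda>i. d ! i"] split[of "\<lambda>i. 1"] sum by simp
  finally show ?thesis by simp
qed

section \<open>The partial sum inequality and uniqueness of the symplectic eigenvalues\<close>

lemma J_mat_mult_index:
  assumes X: "X \<in> carrier_mat (2*n) r" and ab: "a < 2*n" "b < r"
  shows "(J_mat n * X) $$ (a, b) = (if a < n then X $$ (a + n, b) else - X $$ (a - n, b))"
proof -
  have "(J_mat n * X) $$ (a, b) = (\<Sum>c<2*n. J_mat n $$ (a, c) * X $$ (c, b))"
    using X ab by (simp add: scalar_prod_def atLeast0LessThan del: J_mat_index)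
  also have "\<dots> = (\<Sum>c<2*n. if c = (if a < n then a + n else a - n)
       then (if a < n then X $$ (a + n, b) else - X $$ (a - n, b)) else 0)"
    using ab by (intro sum.cong) auto
  finally show ?thesis using ab by auto
qed

lemma mult_J_mat_index:
  assumes X: "X \<in> carrier_mat r (2*n)" and ab: "a < r" "b < 2*n"
  shows "(X * J_mat n) $$ (a, b) = (if b < n then - X $$ (a, b + n) else X $$ (a, b - n))"
proof -
  have "(X * J_mat n) $$ (a, b) = (\<Sum>c<2*n. X $$ (a, c) * J_mat n $$ (c, b))"
    using X ab by (simp add: scalar_prod_def atLeast0LessThan del: J_mat_index)
  also have "\<dots> = (\<Sum>c<2*n. if c = (if b < n then b + n else b - n)
       then (if b < n then - X $$ (a, b + n) else X $$ (a, b - n)) else 0)"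
    using ab by (intro sum.cong) auto
  finally show ?thesis using ab by auto
qed

lemma sum_lessThan_add:
  "(\<Sum>i<n + m. f i) = (\<Sum>i<n. f i) + (\<Sum>i<m. f (n + i :: nat) :: 'a::comm_monoid_add)"
  by (induction m) (auto simp: algebra_simps)

lemma sum_lessThan_double:
  "(\<Sum>i<2 * n. f i) = (\<Sum>i<n. f i + f (n + i :: nat) :: 'a::comm_monoid_add)"
  by (simp add: mult_2 sum_lessThan_add sum.distrib)

section \<open>The normal form under symplectic congruence\<close>

definition diag_double :: "real list \<Rightarrow> real mat" where
  "diag_double d = four_block_mat (diag_of_list d) (0\<^sub>m (length d) (length d)) (0\<^sub>m (length d) (length d)) (diag_of_list d)"

lemma diag_double_carrier:
  "length d = n \<Longrightarrow> diag_double d \<in> carrier_mat (2*n) (2*n)"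
  unfolding diag_double_def diag_of_list_def by (auto simp: mult_2)

lemma diag_double_index:
  assumes "length d = n" "a < 2 * n" "b < 2 * n"
  shows "diag_double d $$ (a, b) = (if a = b then d ! (if a < n then a else a - n) else 0)"
  using assms unfolding diag_double_def diag_of_list_def by auto

lemma williamson_iff:
  "williamson n A d \<longleftrightarrow> length d = n \<and> (\<forall>x \<in> set d. x > 0) \<and>
     (\<exists>M. symplectic n M \<and> transpose_mat M * A * M = diag_double d)"
  unfolding williamson_def diag_double_def by auto

lemma williamson_congruence:
  assumes W: "williamson n A d" and A: "A \<in> carrier_mat (2*n) (2*n)" and S: "symplectic n S"
  shows "williamson n (transpose_mat S * A * S) d"
proof -
  obtain M where M: "symplectic n M" "transpose_mat M * A * M = diag_double d"
    using W unfolding williamson_iff by auto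
  obtain N where N: "symplectic n N" "S * N = 1\<^sub>m (2*n)" using symplectic_inverse[OF S] .
  note c = symplecticD(1)[OF S] symplecticD(1)[OF M(1)] symplecticD(1)[OF N(1)]
  have "transpose_mat (N * M) * (transpose_mat S * A * S) * (N * M)
      = transpose_mat (S * (N * M)) * A * (S * (N * M))"
    using c A by (intro congruence_assoc[symmetric]) auto
  also have "S * (N * M) = M"
    using c N(2) assoc_mult_mat[of S "2*n" "2*n" N "2*n" M "2*n"] by simp
  finally show ?thesis using W symplectic_mult[OF N(1) M(1)] M(2) unfolding williamson_iff by auto
qed

lemma williamsonE:
  assumes W: "williamson n A d" and A: "A \<in> carrier_mat (2*n) (2*n)"
  obtains S where "symplectic n S" "A = transpose_mat S * diag_double d * S"
proof -
  obtain M where M: "symplectic n M" "transpose_mat M * A * M = diag_double d"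
    using W unfolding williamson_iff by auto
  obtain N where N: "symplectic n N" "M * N = 1\<^sub>m (2*n)" using symplectic_inverse[OF M(1)] .
  have "transpose_mat N * (transpose_mat M * A * M) * N = transpose_mat (M * N) * A * (M * N)"
    using symplecticD(1)[OF M(1)] symplecticD(1)[OF N(1)] A by (intro congruence_assoc[symmetric]) auto
  also have "\<dots> = A" using A unfolding N(2) by simp
  finally show thesis using that[OF N(1)] M(2) by simp
qed

lemma diag_double_congruence_index:
  assumes d: "length d = n" and S: "S \<in> carrier_mat (2*n) r" and ab: "a < r" "b < r"
  shows "(transpose_mat S * diag_double d * S) $$ (a, b) =
    (\<Sum>i<n. d ! i * (S $$ (i, a) * S $$ (i, b) + S $$ (n + i, a) * S $$ (n + i, b)))"
proof -
  have "(transpose_mat S * diag_double d * S) $$ (a, b)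
      = (\<Sum>c<2*n. \<Sum>e<2*n. S $$ (c, a) * diag_double d $$ (c, e) * S $$ (e, b))"
    by (rule congruence_index[OF diag_double_carrier[OF d] S ab])
  also have "\<dots> = (\<Sum>c<2*n. \<Sum>e<2*n. if e = c then d ! (if c < n then c else c - n) * S $$ (c, a) * S $$ (c, b) else 0)"
    by (intro sum.cong refl) (auto simp: diag_double_index[OF d])
  also have "\<dots> = (\<Sum>c<2*n. d ! (if c < n then c else c - n) * S $$ (c, a) * S $$ (c, b))"
    by (intro sum.cong refl) auto
  also have "\<dots> = (\<Sum>i<n. d ! i * (S $$ (i, a) * S $$ (i, b) + S $$ (n + i, a) * S $$ (n + i, b)))"
    unfolding sum_lessThan_double by (intro sum.cong refl) (auto simp: algebra_simps)
  finally show ?thesis .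
qed

text \<open>The complex-linear part \<open>P\<close> of a symplectic matrix \<open>S = P + Q\<close> satisfies
  \<open>P\<^sup>T P = I + Q\<^sup>T Q\<close>, where \<open>Q\<close> is the conjugate-linear part.\<close>

definition clinear_part :: "nat \<Rightarrow> real mat \<Rightarrow> real mat" where
  "clinear_part n S = (1/2) \<cdot>\<^sub>m (S - J_mat n * S * J_mat n)"

lemma clinear_part_carrier:
  "S \<in> carrier_mat (2*n) (2*n) \<Longrightarrow> clinear_part n S \<in> carrier_mat (2*n) (2*n)"
  unfolding clinear_part_def by auto

lemma clinear_part_index:
  assumes S: "S \<in> carrier_mat (2*n) (2*n)" and ij: "i < n" "j < n"
  shows "clinear_part n S $$ (i, j) = (S $$ (i, j) + S $$ (n + i, n + j)) / 2"
    "clinear_part n S $$ (n + i, n + j) = (S $$ (i, j) + S $$ (n + i, n + j)) / 2"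
    "clinear_part n S $$ (i, n + j) = (S $$ (i, n + j) - S $$ (n + i, j)) / 2"
    "clinear_part n S $$ (n + i, j) = (S $$ (n + i, j) - S $$ (i, n + j)) / 2"
proof -
  have *: "(J_mat n * S * J_mat n) $$ (a, b) =
      (if b < n then - (J_mat n * S) $$ (a, b + n) else (J_mat n * S) $$ (a, b - n))"
    if "a < 2*n" "b < 2*n" for a b
    using that S by (intro mult_J_mat_index) auto
  have **: "clinear_part n S $$ (a, b) = (S $$ (a, b) - (J_mat n * S * J_mat n) $$ (a, b)) / 2"
    if "a < 2*n" "b < 2*n" for a b
    using that S unfolding clinear_part_def by simp
  show "clinear_part n S $$ (i, j) = (S $$ (i, j) + S $$ (n + i, n + j)) / 2"
    "clinear_part n S $$ (n + i, n + j) = (S $$ (i, j) + S $$ (n + i, n + j)) / 2"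
    "clinear_part n S $$ (i, n + j) = (S $$ (i, n + j) - S $$ (n + i, j)) / 2"
    "clinear_part n S $$ (n + i, j) = (S $$ (n + i, j) - S $$ (i, n + j)) / 2"
    using ij S by (simp_all add: ** * J_mat_mult_index[OF S] add.commute del: index_mult_mat)
qed

text \<open>Put u = Sv and w = JSJv, so that the image of \<open>v\<close> is (u - w)/2.
  Symplecticity gives u.w = -|v|^2, hence |u - w|^2 = |u|^2 + |w|^2 + 2|v|^2. Finally |u + w|^2 >= 0
  shows |u|^2 + |w|^2 >= 2|v|^2.\<close>

lemma symplectic_clinear_part_expanding:
  assumes S: "symplectic n S" and v: "v \<in> carrier_vec (2*n)"
  shows "v \<bullet> v \<le> (clinear_part n S *\<^sub>v v) \<bullet> (clinear_part n S *\<^sub>v v)"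
proof -
  note c = symplecticD(1)[OF S]
  define u where "u = S *\<^sub>v v"
  define w where "w = J_mat n *\<^sub>v (S *\<^sub>v (J_mat n *\<^sub>v v))"
  have uw: "u \<in> carrier_vec (2*n)" "w \<in> carrier_vec (2*n)"
    unfolding u_def w_def using c v by (auto intro!: mult_mat_vec_carrier)
  define B where "B = J_mat n * S * J_mat n"
  have B: "B \<in> carrier_mat (2*n) (2*n)" unfolding B_def using c by auto
  have "B *\<^sub>v v = w"
    unfolding B_def w_def using c v
    by (simp add: assoc_mult_mat_vec[of "J_mat n * S" "2*n" "2*n" _ "2*n"] assoc_mult_mat_vec[of _ "2*n" "2*n" S "2*n"]
      mult_mat_vec_carrier[OF J_mat_carrier(1)] mult_carrier_mat[OF J_mat_carrier(1)] del: assoc_mult_mat)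
  hence "(S - B) *\<^sub>v v = u - w"
    unfolding u_def using minus_mult_distrib_mat_vec[OF c B v] by simp
  moreover have "((1/2) \<cdot>\<^sub>m (S - B)) *\<^sub>v v = (1/2) \<cdot>\<^sub>v ((S - B) *\<^sub>v v)"
    using c B v by (intro eq_vecI) auto
  ultimately have "clinear_part n S *\<^sub>v v = (1/2) \<cdot>\<^sub>v (u - w)"
    unfolding clinear_part_def B_def by simp
  hence 1: "(clinear_part n S *\<^sub>v v) \<bullet> (clinear_part n S *\<^sub>v v) = ((u - w) \<bullet> (u - w)) / 4"
    using uw by simp
  have "u \<bullet> w = v \<bullet> ((transpose_mat S * J_mat n * S) *\<^sub>v (J_mat n *\<^sub>v v))"
    unfolding u_def w_def using c v by (intro congruence_scalar_prod[symmetric]) (auto intro!: mult_mat_vec_carrier)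
  also have "\<dots> = v \<bullet> ((J_mat n * J_mat n) *\<^sub>v v)"
    unfolding symplecticD(2)[OF S] using v by (simp add: assoc_mult_mat_vec[of _ "2*n" "2*n" _ "2*n"])
  also have "\<dots> = - (v \<bullet> v)"
    unfolding J_mat_square using v by simp
  finally have 2: "u \<bullet> w = - (v \<bullet> v)" .
  have "u \<bullet> u + w \<bullet> w \<ge> 2 * (v \<bullet> v)"
    using scalar_prod_diff_self[of u "2*n" "- w"] scalar_prod_self_nonneg[of "u - - w"] uw 2 by simp
  thus ?thesis using 1 2 scalar_prod_diff_self[OF uw] by simp
qed

text \<open>The choice \<open>f\<close> of \<open>k\<close> distinct indices is arbitrary, so that
  the permutation sorting the means can be inserted afterwards. The row weights of the restricted
  complex-linear part bound from below the coefficients of the \<open>d ! i\<close> in the chosen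
  means.\<close>

lemma williamson_partial_sums:
  assumes W: "williamson n A d" and A: "A \<in> carrier_mat (2*n) (2*n)" and "sorted d"
    and f: "inj_on f {..<k}" "\<And>j. j < k \<Longrightarrow> f j < n" and k: "1 \<le> k" "k \<le> n"
  shows "(\<Sum>i<k. d ! i) \<le> (\<Sum>j<k. (A $$ (f j, f j) + A $$ (n + f j, n + f j)) / 2)"
proof -
  have d: "length d = n" "\<And>i. i < n \<Longrightarrow> d ! i > 0"
    using W unfolding williamson_iff by auto
  obtain S where S: "symplectic n S" "A = transpose_mat S * diag_double d * S"
    using williamsonE[OF W A] .
  note c = symplecticD(1)[OF S(1)]
  define P where "P = clinear_part n S"
  have P: "P \<in> carrier_mat (2*n) (2*n)" unfolding P_def by (rule clinear_part_carrier[OF c])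
  \<comment> \<open>\<open>\<kappa>\<close> enumerates the coordinates of the chosen planes: first
    the indices \<open>f j\<close>, then their partners \<open>n + f j\<close>.\<close>
  define \<kappa> where "\<kappa> j = (if j < k then f j else n + f (j - k))" for j
  have \<kappa>: "\<kappa> j < 2*n" if "j < 2*k" for j
    using that f(2)[of j] f(2)[of "j - k"] unfolding \<kappa>_def by auto
  have \<kappa>_inj: "i = j" if "\<kappa> i = \<kappa> j" "i < 2*k" "j < 2*k" for i j
  proof -
    have *: "f i = f j \<Longrightarrow> i = j" if "i < k" "j < k" for i j
      using that f(1) by (auto dest: inj_onD)
    have lt: "f i < n" if "i < k" for i using f(2) that .
    consider "i < k" "j < k" | "i < k" "\<not> j < k" | "\<not> i < k" "j < k" | "\<not> i < k" "\<not> j < k" by blast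
    thus ?thesis
    proof cases
      case 1 thus ?thesis using that(1) * unfolding \<kappa>_def by simp
    next
      case 2 thus ?thesis using that(1) lt[of i] unfolding \<kappa>_def by simp
    next
      case 3 thus ?thesis using that(1) lt[of j] unfolding \<kappa>_def by simp
    next
      case 4
      have "i - k = j - k" using that 4 unfolding \<kappa>_def by (intro *[of "i - k" "j - k"]) auto
      thus ?thesis using 4 by simp
    qed
  qed
  \<comment> \<open>\<open>E\<close> embeds the space of dimension \<open>2*k\<close> isometrically
    onto the chosen planes, so \<open>P * E\<close> inherits the expansion property of
    \<open>P\<close>.\<close>
  define E where "E = mat (2*n) (2*k) (\<lambda>(a, j). if a = \<kappa> j then 1 else 0 :: real)"
  have E: "E \<in> carrier_mat (2*n) (2*k)" unfolding E_def by auto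
  have ETE: "transpose_mat E * E = 1\<^sub>m (2*k)"
  proof (rule eq_matI)
    fix i j assume "i < dim_row (1\<^sub>m (2*k) :: real mat)" "j < dim_col (1\<^sub>m (2*k) :: real mat)"
    hence ij: "i < 2*k" "j < 2*k" by auto
    have "(transpose_mat E * E) $$ (i, j) = (\<Sum>a<2*n. E $$ (a, i) * E $$ (a, j))"
      using ij E by (simp add: scalar_prod_def atLeast0LessThan)
    also have "\<dots> = (\<Sum>a<2*n. if a = \<kappa> i then (if i = j then 1 else 0) else 0)"
      using ij \<kappa>_inj[of i j] by (intro sum.cong) (auto simp: E_def)
    also have "\<dots> = (if i = j then 1 else 0)"
      using \<kappa>[OF ij(1)] by simp
    finally show "(transpose_mat E * E) $$ (i, j) = 1\<^sub>m (2*k) $$ (i, j)" using ij by simp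
  qed (use E in auto)
  define X where "X = P * E"
  have X: "X \<in> carrier_mat (2*n) (2*k)" unfolding X_def using P E by auto
  have X_index: "X $$ (a, j) = P $$ (a, \<kappa> j)" if aj: "a < 2*n" "j < 2*k" for a j
  proof -
    have "X $$ (a, j) = (\<Sum>b<2*n. P $$ (a, b) * E $$ (b, j))"
      unfolding X_def using aj P E by (simp add: scalar_prod_def atLeast0LessThan)
    also have "\<dots> = (\<Sum>b<2*n. if b = \<kappa> j then P $$ (a, \<kappa> j) else 0)"
      using aj by (intro sum.cong) (auto simp: E_def)
    finally show ?thesis using \<kappa>[OF aj(2)] by simp
  qed
  have "v \<bullet> v \<le> (X *\<^sub>v v) \<bullet> (X *\<^sub>v v)" if v: "v \<in> carrier_vec (2*k)" for v
  proof -
    have "v \<bullet> v = v \<bullet> ((transpose_mat E * E) *\<^sub>v v)" unfolding ETE using v by simp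
    also have "(transpose_mat E * E) *\<^sub>v v = transpose_mat E *\<^sub>v (E *\<^sub>v v)"
      using E v by (intro assoc_mult_mat_vec) auto
    also have "v \<bullet> \<dots> = (E *\<^sub>v v) \<bullet> (E *\<^sub>v v)"
      using E v by (subst scalar_prod_mult_mat_vec[of _ "2*k" "2*n"]) auto
    also have "\<dots> \<le> (P *\<^sub>v (E *\<^sub>v v)) \<bullet> (P *\<^sub>v (E *\<^sub>v v))"
      unfolding P_def using E v by (intro symplectic_clinear_part_expanding[OF S(1)]) auto
    also have "P *\<^sub>v (E *\<^sub>v v) = X *\<^sub>v v"
      unfolding X_def using P E v by (intro assoc_mult_mat_vec[symmetric]) auto
    finally show ?thesis .
  qed
  from expanding_mat_row_weights[OF X this] obtain w
    where w: "\<And>a. a < 2*n \<Longrightarrow> 0 \<le> w a \<and> w a \<le> 1 \<and> w a \<le> row X a \<bullet> row X a"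
      "(\<Sum>a<2*n. w a) = real (2*k)" by blast
  \<comment> \<open>Rows \<open>i\<close> and \<open>n + i\<close> share the factor
    \<open>d ! i\<close>; averaging over them turns \<open>2*n\<close> weights of total
    \<open>2*k\<close> into \<open>n\<close> weights in [0, 1] of total \<open>k\<close>. The number
    \<open>s i\<close> is the coefficient of \<open>d ! i\<close> in the sum of the chosen
    means.\<close>
  define e where "e i = (w i + w (n + i)) / 2" for i
  define s where "s i = (\<Sum>j<k. (S $$ (i, f j))\<^sup>2 + (S $$ (n + i, f j))\<^sup>2
      + (S $$ (i, n + f j))\<^sup>2 + (S $$ (n + i, n + f j))\<^sup>2) / 2" for i
  have e_le: "e i \<le> s i" if i: "i < n" for i
  proof -
    have row: "row X a \<bullet> row X a = (\<Sum>j<k. (P $$ (a, f j))\<^sup>2 + (P $$ (a, n + f j))\<^sup>2)" if a: "a < 2*n" for a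
    proof -
      have "row X a \<bullet> row X a = (\<Sum>j<2*k. (P $$ (a, \<kappa> j))\<^sup>2)"
        using a X X_index by (simp add: scalar_prod_def atLeast0LessThan power2_eq_square)
      also have "\<dots> = (\<Sum>j<k. (P $$ (a, f j))\<^sup>2 + (P $$ (a, n + f j))\<^sup>2)"
        unfolding sum_lessThan_double by (intro sum.cong) (auto simp: \<kappa>_def)
      finally show ?thesis .
    qed
    have "2 * e i \<le> row X i \<bullet> row X i + row X (n + i) \<bullet> row X (n + i)"
      unfolding e_def using w(1)[of i] w(1)[of "n + i"] i by simp
    also have "\<dots> = (\<Sum>j<k. (P $$ (i, f j))\<^sup>2 + (P $$ (i, n + f j))\<^sup>2
        + ((P $$ (n + i, f j))\<^sup>2 + (P $$ (n + i, n + f j))\<^sup>2))"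
      using i by (simp add: row sum.distrib)
    also have "\<dots> \<le> (\<Sum>j<k. (S $$ (i, f j))\<^sup>2 + (S $$ (n + i, f j))\<^sup>2
      + (S $$ (i, n + f j))\<^sup>2 + (S $$ (n + i, n + f j))\<^sup>2)"
    proof (intro sum_mono)
      fix j assume j: "j \<in> {..<k}"
      \<comment> \<open>For a 2x2 block of \<open>S\<close>, passing to the complex-linear part does
        not increase the Frobenius norm. The gap is the squared norm of the conjugate-linear
        part.\<close>
      have "((x + u) / 2)\<^sup>2 + ((y - z) / 2)\<^sup>2 + (((z - y) / 2)\<^sup>2 + ((x + u) / 2)\<^sup>2) \<le> x\<^sup>2 + z\<^sup>2 + y\<^sup>2 + u\<^sup>2" for x y z u :: real
      proof -
        have "x\<^sup>2 + z\<^sup>2 + y\<^sup>2 + u\<^sup>2 - (((x + u) / 2)\<^sup>2 + ((y - z) / 2)\<^sup>2 + (((z - y) / 2)\<^sup>2 + ((x + u) / 2)\<^sup>2))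
          = ((x - u)\<^sup>2 + (y + z)\<^sup>2) / 2"
          by (simp add: power2_eq_square field_simps)
        also have "\<dots> \<ge> 0" by simp
        finally show ?thesis by linarith
      qed
      thus "(P $$ (i, f j))\<^sup>2 + (P $$ (i, n + f j))\<^sup>2 + ((P $$ (n + i, f j))\<^sup>2 + (P $$ (n + i, n + f j))\<^sup>2)
        \<le> (S $$ (i, f j))\<^sup>2 + (S $$ (n + i, f j))\<^sup>2 + (S $$ (i, n + f j))\<^sup>2 + (S $$ (n + i, n + f j))\<^sup>2"
        using j f(2)[of j] i unfolding P_def by (simp add: clinear_part_index[OF c])
    qed
    finally show ?thesis unfolding s_def by simp
  qed
  have "(\<Sum>i<k. d ! i) \<le> (\<Sum>i<length d. d ! i * e i)"
  proof (rule weighted_sum_ge_sum_smallest[OF \<open>sorted d\<close>])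
    show "0 \<le> e i \<and> e i \<le> 1" if "i < length d" for i
      using w(1)[of i] w(1)[of "n + i"] that d unfolding e_def by auto
    show "(\<Sum>i<length d. e i) = real k"
      using w(2) unfolding sum_lessThan_double d e_def by (simp flip: sum_divide_distrib)
  qed (use k d in auto)
  also have "\<dots> \<le> (\<Sum>i<n. d ! i * s i)"
    unfolding d using e_le d(2) by (intro sum_mono mult_left_mono) (auto simp: less_imp_le)
  also have "\<dots> = (\<Sum>j<k. (A $$ (f j, f j) + A $$ (n + f j, n + f j)) / 2)"
  proof -
    have "(A $$ (f j, f j) + A $$ (n + f j, n + f j)) / 2 = (\<Sum>i<n. d ! i * (((S $$ (i, f j))\<^sup>2 + (S $$ (n + i, f j))\<^sup>2
      + (S $$ (i, n + f j))\<^sup>2 + (S $$ (n + i, n + f j))\<^sup>2) / 2))" if j: "j < k" for j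
    proof -
      have fj: "f j < 2*n" "n + f j < 2*n" using f(2)[OF j] by auto
      show ?thesis
        unfolding S(2) diag_double_congruence_index[OF d(1) c fj(1) fj(1)] diag_double_congruence_index[OF d(1) c fj(2) fj(2)]
          sum.distrib[symmetric] sum_divide_distrib
        by (intro sum.cong refl) (simp add: field_simps power2_eq_square)
    qed
    hence "(\<Sum>j<k. (A $$ (f j, f j) + A $$ (n + f j, n + f j)) / 2) = (\<Sum>j<k. \<Sum>i<n. d ! i * (((S $$ (i, f j))\<^sup>2 + (S $$ (n + i, f j))\<^sup>2
      + (S $$ (i, n + f j))\<^sup>2 + (S $$ (n + i, n + f j))\<^sup>2) / 2))"
      by (intro sum.cong refl) simp
    also have "\<dots> = (\<Sum>i<n. d ! i * s i)"
      by (subst sum.swap) (simp add: s_def sum_distrib_left sum_divide_distrib)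
    finally show ?thesis by simp
  qed
  finally show ?thesis .
qed

section \<open>Weak supermajorisation and uniqueness\<close>

lemma length_Delta_c [simp]: "length (Delta_c n A) = n"
  unfolding Delta_c_def by simp

lemma Delta_c_nth [simp]: "j < n \<Longrightarrow> Delta_c n A ! j = (A $$ (j, j) + A $$ (n + j, n + j)) / 2"
  unfolding Delta_c_def by simp

lemma sum_list_take:
  "k \<le> length xs \<Longrightarrow> sum_list (take k xs) = (\<Sum>i<k. xs ! i :: 'a::comm_monoid_add)"
  by (simp add: sum_list_sum_nth atLeast0LessThan)

lemma sort_bij_nth:
  obtains f where "bij_betw f {..<length xs} {..<length xs}" "\<And>i. i < length xs \<Longrightarrow> sort xs ! i = xs ! f i"
  using permutation_Ex_bij[of "sort xs" xs] by auto

lemma williamson_weak_supmaj: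
  assumes W: "williamson n A d" and A: "A \<in> carrier_mat (2*n) (2*n)" and "sorted d"
  shows "weak_supmaj (Delta_c n A) d"
  unfolding weak_supmaj_def
proof (intro conjI ballI)
  show len: "length (Delta_c n A) = length d" using W unfolding williamson_def by simp
  fix k assume "k \<in> {1..length (Delta_c n A)}"
  hence k: "1 \<le> k" "k \<le> n" by auto
  obtain f where f: "bij_betw f {..<n} {..<n}" "\<And>i. i < n \<Longrightarrow> sort (Delta_c n A) ! i = Delta_c n A ! f i"
    using sort_bij_nth[of "Delta_c n A"] by auto
  have fn: "f j < n" if "j < n" for j using f(1) that by (auto dest: bij_betwE)
  have "inj_on f {..<k}" using f(1) k by (auto simp: bij_betw_def intro: inj_on_subset)
  hence "(\<Sum>i<k. d ! i) \<le> (\<Sum>j<k. (A $$ (f j, f j) + A $$ (n + f j, n + f j)) / 2)"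
    using k fn by (intro williamson_partial_sums[OF W A \<open>sorted d\<close>]) auto
  also have "\<dots> = (\<Sum>j<k. sort (Delta_c n A) ! j)"
    using k by (intro sum.cong refl) (simp add: f(2) fn)
  finally show "sum_list (take k (sort d)) \<le> sum_list (take k (sort (Delta_c n A)))"
    using k len \<open>sorted d\<close> by (simp add: sum_list_take sorted_sort_id)
qed

lemma Delta_c_diag_double: "length d = n \<Longrightarrow> Delta_c n (diag_double d) = d"
  by (rule nth_equalityI) (auto simp: diag_double_index)

lemma weak_supmaj_antisym:
  assumes "weak_supmaj x y" "weak_supmaj y x" "sorted x" "sorted y"
  shows "x = y"
proof (rule nth_equalityI)
  show len: "length x = length y" using assms(1) unfolding weak_supmaj_def by simp
  have eq: "(\<Sum>i<k. x ! i) = (\<Sum>i<k. y ! i)" if "k \<le> length x" for k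
  proof (cases "k = 0")
    case False
    hence "k \<in> {1..length x}" "k \<in> {1..length y}" using that len by auto
    hence "sum_list (take k (sort x)) = sum_list (take k (sort y))"
      using assms(1,2) unfolding weak_supmaj_def by (intro order_antisym) blast+
    moreover have "sort x = x" "sort y = y"
      using assms(3,4) by (auto intro: sorted_sort_id)
    ultimately show ?thesis
      using that len sum_list_take[of k x] sum_list_take[of k y] by simp
  qed simp
  show "x ! i = y ! i" if "i < length x" for i
    using eq[of i] eq[of "Suc i"] that by simp
qed

text \<open>Carrying \<open>A\<close> to \<open>diag_double d'\<close> makes \<open>d'\<close> the
  list of means, while \<open>d\<close> remains a normal form. The partial sum inequality gives
  \<open>weak_supmaj d' d\<close>; exchanging the roles gives the reverse.\<close>

lemma williamson_unique:
  assumes A: "A \<in> carrier_mat (2*n) (2*n)"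
    and d: "williamson n A d" "sorted d" and d': "williamson n A d'" "sorted d'"
  shows "d = d'"
proof -
  have *: "weak_supmaj d' d" if W: "williamson n A d" "sorted d" and W': "williamson n A d'" for d d'
  proof -
    obtain M where M: "symplectic n M" "transpose_mat M * A * M = diag_double d'" and len: "length d' = n"
      using W' unfolding williamson_iff by auto
    have "williamson n (diag_double d') d"
      using williamson_congruence[OF W(1) A M(1)] M(2) by simp
    from williamson_weak_supmaj[OF this diag_double_carrier[OF len] W(2)] show ?thesis
      using len by (simp add: Delta_c_diag_double)
  qed
  show ?thesis using *[OF d d'(1)] *[OF d' d(1)] d d' by (auto intro: weak_supmaj_antisym)
qed

text \<open>Uniqueness resolves the definite description in \<open>sympl_eigvals\<close>.\<close>

lemma sympl_eigvals_eqI: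
  assumes "A \<in> carrier_mat (2*n) (2*n)" "williamson n A d" "sorted d"
  shows "sympl_eigvals n A = d"
  unfolding sympl_eigvals_def using assms williamson_unique by (intro the_equality) auto

section \<open>Existence of the Williamson normal form\<close>

text \<open>\<open>Y\<close> lies in the symplectic Lie algebra and squares to zero, so
  \<open>1 + Y\<close> is its exponential. Directly: (J - JY)(1 + Y) = J - JYY = J.\<close>

lemma symplectic_one_plus:
  assumes Y: "Y \<in> carrier_mat (2*n) (2*n)" and YJ: "transpose_mat Y * J_mat n = - (J_mat n * Y)"
    and YY: "Y * Y = 0\<^sub>m (2*n) (2*n)"
  shows "symplectic n (1\<^sub>m (2*n) + Y)"
proof -
  let ?I = "1\<^sub>m (2*n) :: real mat" and ?J = "J_mat n"
  have JY: "?J * Y \<in> carrier_mat (2*n) (2*n)" using Y by auto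
  have "transpose_mat (?I + Y) * ?J = (?I + transpose_mat Y) * ?J"
    using Y by (simp add: transpose_add[of _ "2*n" "2*n"])
  also have "\<dots> = ?J + - (?J * Y)"
    using Y YJ by (simp add: add_mult_distrib_mat[of _ "2*n" "2*n" _ _ "2*n"] left_mult_one_mat[OF J_mat_carrier(1)])
  also have "\<dots> = ?J - ?J * Y" using JY by (intro eq_matI) auto
  finally have 1: "transpose_mat (?I + Y) * ?J = ?J - ?J * Y" .
  have 2: "(?J - ?J * Y) * (?I + Y) = (?J - ?J * Y) * ?I + (?J - ?J * Y) * Y"
    using Y JY by (intro mult_add_distrib_mat[of _ "2*n" "2*n"] minus_carrier_mat) auto
  have 3: "(?J - ?J * Y) * ?I = ?J - ?J * Y"
    using JY by (intro right_mult_one_mat minus_carrier_mat)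
  have "(?J - ?J * Y) * Y = ?J * Y - ?J * Y * Y"
    using Y JY by (intro minus_mult_distrib_mat[of _ "2*n" "2*n"]) auto
  also have "?J * Y * Y = ?J * (Y * Y)" using Y by (intro assoc_mult_mat[of _ "2*n" "2*n" _ "2*n"]) auto
  also have "\<dots> = 0\<^sub>m (2*n) (2*n)" unfolding YY by (intro right_mult_zero_mat[of _ "2*n"]) auto
  finally have 4: "(?J - ?J * Y) * Y = ?J * Y - 0\<^sub>m (2*n) (2*n)" .
  have "?J - ?J * Y + (?J * Y - 0\<^sub>m (2*n) (2*n)) = ?J"
    using JY by (intro eq_matI) auto
  thus ?thesis using Y unfolding symplectic_def 1 2 3 4 by auto
qed

section \<open>Symplectic transvections\<close>

lemma J_mat_skew:
  assumes "w \<in> carrier_vec (2*n)"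
  shows "w \<bullet> (J_mat n *\<^sub>v w) = 0"
proof -
  have "w \<bullet> (J_mat n *\<^sub>v w) = (- J_mat n *\<^sub>v w) \<bullet> w"
    using assms by (simp add: scalar_prod_mult_mat_vec[of _ "2*n" "2*n"] transpose_J_mat)
  also have "\<dots> = - (w \<bullet> (J_mat n *\<^sub>v w))"
    using assms by (simp add: comm_scalar_prod[of w "2*n"] mult_mat_vec_carrier[OF J_mat_carrier(1)])
  finally show ?thesis by simp
qed

text \<open>With g = Jw, the product w.v is the symplectic form of g and v. Hence this is the
  classical transvection along g, sending v to v + t (w.v) g.\<close>

definition transvection :: "nat \<Rightarrow> real \<Rightarrow> real vec \<Rightarrow> real mat" where
  "transvection n t w = 1\<^sub>m (2*n) + mat (2*n) (2*n) (\<lambda>(a, b). t * (J_mat n *\<^sub>v w) $ a * w $ b)"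

text \<open>For Y = t (Jw) w^T the matrix JY = -t w w^T is symmetric, which is the Lie algebra
  condition, and Y^2 = 0 because w.Jw = 0.\<close>

lemma symplectic_transvection:
  assumes w: "w \<in> carrier_vec (2*n)"
  shows "symplectic n (transvection n t w)"
  unfolding transvection_def
proof (rule symplectic_one_plus)
  define g where "g = J_mat n *\<^sub>v w"
  have g: "g \<in> carrier_vec (2*n)" unfolding g_def using w by simp
  have Jg: "J_mat n *\<^sub>v g = - w"
    unfolding g_def using w assoc_mult_mat_vec[OF J_mat_carrier(1) J_mat_carrier(1) w]
    by (simp add: J_mat_square)
  let ?Y = "mat (2*n) (2*n) (\<lambda>(a, b). t * (J_mat n *\<^sub>v w) $ a * w $ b)"
  show "transpose_mat ?Y * J_mat n = - (J_mat n * ?Y)"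
  proof (rule eq_matI)
    fix a b assume "a < dim_row (- (J_mat n * ?Y))" "b < dim_col (- (J_mat n * ?Y))"
    hence ab: "a < 2*n" "b < 2*n" by auto
    have 1: "(\<Sum>c<2*n. J_mat n $$ (a, c) * g $ c) = - w $ a" if "a < 2*n" for a
    proof -
      have "(J_mat n *\<^sub>v g) $ a = (\<Sum>c<2*n. J_mat n $$ (a, c) * g $ c)"
        using that g by (simp add: scalar_prod_def atLeast0LessThan del: J_mat_index)
      thus ?thesis unfolding Jg using that w by simp
    qed
    have "(transpose_mat ?Y * J_mat n) $$ (a, b) = (\<Sum>c<2*n. t * g $ c * w $ a * J_mat n $$ (c, b))"
      using ab by (simp add: scalar_prod_def atLeast0LessThan g_def del: J_mat_index)
    also have "\<dots> = - t * w $ a * (\<Sum>c<2*n. J_mat n $$ (b, c) * g $ c)"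
      unfolding sum_distrib_left using ab by (intro sum.cong) auto
    also have "\<dots> = t * w $ a * w $ b" using 1[OF ab(2)] by simp
    finally have L: "(transpose_mat ?Y * J_mat n) $$ (a, b) = t * w $ a * w $ b" .
    have "(J_mat n * ?Y) $$ (a, b) = (\<Sum>c<2*n. J_mat n $$ (a, c) * (t * g $ c * w $ b))"
      using ab by (simp add: scalar_prod_def atLeast0LessThan g_def del: J_mat_index)
    also have "\<dots> = t * w $ b * (\<Sum>c<2*n. J_mat n $$ (a, c) * g $ c)"
      unfolding sum_distrib_left by (intro sum.cong) auto
    also have "\<dots> = - t * w $ a * w $ b" using 1[OF ab(1)] by simp
    finally show "(transpose_mat ?Y * J_mat n) $$ (a, b) = (- (J_mat n * ?Y)) $$ (a, b)"
      using L ab by simp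
  qed auto
  show "?Y * ?Y = 0\<^sub>m (2*n) (2*n)"
  proof (rule eq_matI)
    fix a b assume "a < dim_row (0\<^sub>m (2*n) (2*n) :: real mat)" "b < dim_col (0\<^sub>m (2*n) (2*n) :: real mat)"
    hence ab: "a < 2*n" "b < 2*n" by auto
    have "(?Y * ?Y) $$ (a, b) = (\<Sum>c<2*n. (t * g $ a * w $ c) * (t * g $ c * w $ b))"
      using ab by (simp add: scalar_prod_def atLeast0LessThan g_def)
    also have "\<dots> = t * t * g $ a * w $ b * (\<Sum>c<2*n. w $ c * g $ c)"
      unfolding sum_distrib_left by (intro sum.cong) auto
    also have "(\<Sum>c<2*n. w $ c * g $ c) = w \<bullet> g"
      using g by (simp add: scalar_prod_def atLeast0LessThan)
    finally show "(?Y * ?Y) $$ (a, b) = 0\<^sub>m (2*n) (2*n) $$ (a, b)"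
      using ab J_mat_skew[OF w] unfolding g_def by simp
  qed auto
qed auto

lemma transvection_unit_vec:
  assumes w: "w \<in> carrier_vec (2*n)" and a: "a < 2*n"
  shows "transvection n t w *\<^sub>v unit_vec (2*n) a = unit_vec (2*n) a + (t * w $ a) \<cdot>\<^sub>v (J_mat n *\<^sub>v w)"
proof -
  have "transvection n t w *\<^sub>v unit_vec (2*n) a = col (transvection n t w) a"
    using a by (intro mult_mat_unit_vec) (auto simp: transvection_def)
  thus ?thesis using a w by (intro eq_vecI) (auto simp: transvection_def)
qed

section \<open>Stationarity of a weighted trace\<close>

lemma quad_form_add_smult:
  fixes B :: "real mat"
  assumes B: "B \<in> carrier_mat m m" "transpose_mat B = B" and u: "u \<in> carrier_vec m" "v \<in> carrier_vec m"
  shows "(u + t \<cdot>\<^sub>v v) \<bullet> (B *\<^sub>v (u + t \<cdot>\<^sub>v v)) = u \<bullet> (B *\<^sub>v u) + 2 * t * (u \<bullet> (B *\<^sub>v v)) + t\<^sup>2 * (v \<bullet> (B *\<^sub>v v))"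
proof -
  have 1: "B *\<^sub>v (u + t \<cdot>\<^sub>v v) = B *\<^sub>v u + t \<cdot>\<^sub>v (B *\<^sub>v v)"
    using B(1) u by (simp add: mult_add_distrib_mat_vec[of _ m m] mult_mat_vec[of _ m m])
  have 2: "v \<bullet> (B *\<^sub>v u) = u \<bullet> (B *\<^sub>v v)"
    using B u scalar_prod_mult_mat_vec[of B m m u v] comm_scalar_prod[of u m "B *\<^sub>v v"] by auto
  have c: "B *\<^sub>v u \<in> carrier_vec m" "B *\<^sub>v v \<in> carrier_vec m" using B u by auto
  have "(u + t \<cdot>\<^sub>v v) \<bullet> (B *\<^sub>v u + t \<cdot>\<^sub>v (B *\<^sub>v v)) =
    u \<bullet> (B *\<^sub>v u) + t * (u \<bullet> (B *\<^sub>v v)) + t * (v \<bullet> (B *\<^sub>v u)) + t * t * (v \<bullet> (B *\<^sub>v v))"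
    using u c by (simp add: add_scalar_prod_distrib[of _ m] scalar_prod_add_distrib[of _ m] algebra_simps)
  thus ?thesis unfolding 1 2 by (simp add: algebra_simps power2_eq_square)
qed

lemma linear_coeff_eq_0:
  fixes L K :: real
  assumes "\<And>t. 0 \<le> 2 * t * L + t\<^sup>2 * K"
  shows "L = 0"
proof (rule ccontr)
  assume "L \<noteq> 0"
  \<comment> \<open>The denominator makes \<open>s * K < 1\<close> for \<open>K\<close> of either
    sign, so the polynomial is negative at \<open>t = - s * L\<close>.\<close>
  define s where "s = 1 / (\<bar>K\<bar> + 1)"
  have s: "s > 0" "s * K < 1" unfolding s_def by (auto simp: field_simps)
  have "2 * (- s * L) * L + (- s * L)\<^sup>2 * K = (s * L\<^sup>2) * (s * K - 2)"
    by (simp add: algebra_simps power2_eq_square)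
  also have "\<dots> < 0" using s \<open>L \<noteq> 0\<close> by (intro mult_pos_neg) auto
  finally show False using assms[of "- s * L"] by simp
qed

lemma quad_form_unit_vec:
  "B \<in> carrier_mat m m \<Longrightarrow> a < m \<Longrightarrow> unit_vec m a \<bullet> (B *\<^sub>v unit_vec m a) = (B $$ (a, a) :: real)"
  by (simp add: mult_mat_unit_vec)

lemma congruence_diag:
  fixes B S :: "real mat"
  assumes "B \<in> carrier_mat m m" "S \<in> carrier_mat m m" "a < m"
  shows "(transpose_mat S * B * S) $$ (a, a) = (S *\<^sub>v unit_vec m a) \<bullet> (B *\<^sub>v (S *\<^sub>v unit_vec m a))"
proof -
  have "(transpose_mat S * B * S) $$ (a, a) = unit_vec m a \<bullet> ((transpose_mat S * B * S) *\<^sub>v unit_vec m a)"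
    using assms by (intro quad_form_unit_vec[symmetric] congruence_carrier)
  thus ?thesis using assms by (subst (asm) congruence_scalar_prod[of _ m _ m]) auto
qed

text \<open>Along the transvections in a fixed direction the weighted trace is exactly a quadratic
  polynomial in \<open>t\<close>. Minimality at \<open>t = 0\<close> makes its linear coefficient
  vanish, so no derivative is taken.\<close>

lemma weighted_trace_stationary:
  fixes c :: "nat \<Rightarrow> real"
  assumes B: "B \<in> carrier_mat (2*n) (2*n)" "transpose_mat B = B"
    and min: "\<And>S. symplectic n S \<Longrightarrow>
      (\<Sum>a<2*n. c a * B $$ (a, a)) \<le> (\<Sum>a<2*n. c a * (transpose_mat S * B * S) $$ (a, a))"
    and w: "w \<in> carrier_vec (2*n)"
  shows "(\<Sum>a<2*n. c a * w $ a * ((B * J_mat n) *\<^sub>v w) $ a) = 0"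
proof (rule linear_coeff_eq_0)
  fix t :: real
  define g where "g = J_mat n *\<^sub>v w"
  have g: "g \<in> carrier_vec (2*n)" unfolding g_def using w by simp
  have Bg: "(B * J_mat n) *\<^sub>v w = B *\<^sub>v g"
    unfolding g_def using B w by (intro assoc_mult_mat_vec) auto
  let ?T = "transvection n t w"
  note T = symplectic_transvection[OF w, of t]
  have "(transpose_mat ?T * B * ?T) $$ (a, a) = B $$ (a, a) + 2 * t * (w $ a * (B *\<^sub>v g) $ a) + t\<^sup>2 * ((w $ a)\<^sup>2 * (g \<bullet> (B *\<^sub>v g)))"
    if a: "a < 2*n" for a
  proof -
    have "(transpose_mat ?T * B * ?T) $$ (a, a) = (?T *\<^sub>v unit_vec (2*n) a) \<bullet> (B *\<^sub>v (?T *\<^sub>v unit_vec (2*n) a))"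
      by (rule congruence_diag[OF B(1) symplecticD(1)[OF T] a])
    also have "\<dots> = unit_vec (2*n) a \<bullet> (B *\<^sub>v unit_vec (2*n) a) + 2 * (t * w $ a) * (unit_vec (2*n) a \<bullet> (B *\<^sub>v g)) + (t * w $ a)\<^sup>2 * (g \<bullet> (B *\<^sub>v g))"
      unfolding transvection_unit_vec[OF w a] g_def[symmetric]
      using g by (intro quad_form_add_smult[OF B]) auto
    also have "unit_vec (2*n) a \<bullet> (B *\<^sub>v unit_vec (2*n) a) = B $$ (a, a)"
      by (rule quad_form_unit_vec[OF B(1) a])
    also have "unit_vec (2*n) a \<bullet> (B *\<^sub>v g) = (B *\<^sub>v g) $ a"
      using a B g by simp
    finally show ?thesis by (simp add: power_mult_distrib algebra_simps)
  qed
  hence "(\<Sum>a<2*n. c a * (transpose_mat ?T * B * ?T) $$ (a, a)) =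
     (\<Sum>a<2*n. c a * (B $$ (a, a) + 2 * t * (w $ a * (B *\<^sub>v g) $ a) + t\<^sup>2 * ((w $ a)\<^sup>2 * (g \<bullet> (B *\<^sub>v g)))))"
    by (intro sum.cong refl) simp
  also have "\<dots> = (\<Sum>a<2*n. c a * B $$ (a, a)) + 2 * t * (\<Sum>a<2*n. c a * w $ a * ((B * J_mat n) *\<^sub>v w) $ a)
      + t\<^sup>2 * (\<Sum>a<2*n. c a * ((w $ a)\<^sup>2 * (g \<bullet> (B *\<^sub>v g))))"
    unfolding Bg sum_distrib_left sum.distrib[symmetric] by (intro sum.cong refl) (simp add: algebra_simps)
  finally show "0 \<le> 2 * t * (\<Sum>a<2*n. c a * w $ a * ((B * J_mat n) *\<^sub>v w) $ a)
      + t\<^sup>2 * (\<Sum>a<2*n. c a * ((w $ a)\<^sup>2 * (g \<bullet> (B *\<^sub>v g))))"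
    using min[OF T] by simp
qed

text \<open>With C the diagonal matrix of the weights, stationarity says that the quadratic form of
  C B J is zero. Polarising with sums of two unit vectors shows that C B J is antisymmetric.\<close>

lemma weighted_trace_stationary_skew:
  fixes c :: "nat \<Rightarrow> real"
  assumes B: "B \<in> carrier_mat (2*n) (2*n)" "transpose_mat B = B"
    and min: "\<And>S. symplectic n S \<Longrightarrow>
      (\<Sum>a<2*n. c a * B $$ (a, a)) \<le> (\<Sum>a<2*n. c a * (transpose_mat S * B * S) $$ (a, a))"
    and pq: "p < 2*n" "q < 2*n"
  shows "c p * (B * J_mat n) $$ (p, q) = - (c q * (B * J_mat n) $$ (q, p))"
proof -
  define K where "K = B * J_mat n"
  have K: "K \<in> carrier_mat (2*n) (2*n)" unfolding K_def using B by auto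
  define \<phi> where "\<phi> w = (\<Sum>a<2*n. c a * w $ a * (K *\<^sub>v w) $ a)" for w
  have \<phi>0: "\<phi> w = 0" if "w \<in> carrier_vec (2*n)" for w
    unfolding \<phi>_def K_def using weighted_trace_stationary[OF B min that] .
  have delta: "(\<Sum>a<2*n. c a * unit_vec (2*n) p $ a * f a) = c p * f p" if "p < 2*n" for p and f :: "nat \<Rightarrow> real"
  proof -
    have "(\<Sum>a<2*n. c a * unit_vec (2*n) p $ a * f a) = (\<Sum>a<2*n. if a = p then c p * f p else 0)"
      using that by (intro sum.cong) auto
    thus ?thesis using that by simp
  qed
  have diag: "c p * K $$ (p, p) = 0" if p: "p < 2*n" for p
    using \<phi>0[of "unit_vec (2*n) p"] delta[OF p] p K unfolding \<phi>_def by (simp add: mult_mat_unit_vec)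
  let ?w = "unit_vec (2*n) p + unit_vec (2*n) q :: real vec"
  have "0 = \<phi> ?w" using \<phi>0[of ?w] by simp
  also have "\<dots> = (\<Sum>a<2*n. c a * unit_vec (2*n) p $ a * (K *\<^sub>v ?w) $ a) + (\<Sum>a<2*n. c a * unit_vec (2*n) q $ a * (K *\<^sub>v ?w) $ a)"
    unfolding \<phi>_def sum.distrib[symmetric] by (intro sum.cong refl) (auto simp: algebra_simps)
  also have "\<dots> = c p * (K *\<^sub>v ?w) $ p + c q * (K *\<^sub>v ?w) $ q"
    using pq by (simp only: delta)
  also have "K *\<^sub>v ?w = col K p + col K q"
    using K pq by (simp add: mult_add_distrib_mat_vec[of _ "2*n" "2*n"] mult_mat_unit_vec)
  finally show ?thesis
    using diag[OF pq(1)] diag[OF pq(2)] K pq by (simp add: algebra_simps flip: K_def)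
qed

section \<open>Compactness and the minimiser\<close>

lemma pos_def_coord_bound:
  assumes A: "pos_def m A"
  obtains C where "C \<ge> 0" "\<And>x p. x \<in> carrier_vec m \<Longrightarrow> p < m \<Longrightarrow> (x $ p)\<^sup>2 \<le> C * (x \<bullet> (A *\<^sub>v x))"
proof -
  note cA = pos_defD[OF A]
  have nonneg: "x \<bullet> (A *\<^sub>v x) \<ge> 0" if "x \<in> carrier_vec m" for x
    using cA(3)[OF that] that cA(1) by (cases "x = 0\<^sub>v m") (auto simp: less_imp_le)
  obtain H where H: "H \<in> carrier_mat m m" "A * H = 1\<^sub>m m"
  proof (rule inverse_if_kernel_trivial[OF cA(1)])
    fix v assume v: "v \<in> carrier_vec m" "A *\<^sub>v v = 0\<^sub>v m"
    hence "v \<bullet> (A *\<^sub>v v) = 0" by simp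
    thus "v = 0\<^sub>v m" using cA(3)[OF v(1)] by force
  qed
  \<comment> \<open>Summing over the diagonal of the inverse yields one constant for all
    coordinates.\<close>
  define C where "C = (\<Sum>p<m. \<bar>H $$ (p, p)\<bar>)"
  have "(x $ p)\<^sup>2 \<le> C * (x \<bullet> (A *\<^sub>v x))" if x: "x \<in> carrier_vec m" and p: "p < m" for x p
  proof -
    define g where "g = col H p"
    have g: "g \<in> carrier_vec m" unfolding g_def using H p by auto
    have Ag: "A *\<^sub>v g = unit_vec m p"
    proof -
      have "A *\<^sub>v g = A *\<^sub>v (H *\<^sub>v unit_vec m p)" unfolding g_def using H p by (simp add: mult_mat_unit_vec)
      also have "\<dots> = (A * H) *\<^sub>v unit_vec m p" using cA H by (intro assoc_mult_mat_vec[symmetric]) auto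
      finally show ?thesis using H by simp
    qed
    have gp: "g \<bullet> (A *\<^sub>v g) = g $ p" unfolding Ag using g p by simp
    have "g \<noteq> 0\<^sub>v m"
    proof
      assume "g = 0\<^sub>v m"
      hence "unit_vec m p = (0\<^sub>v m :: real vec)" using Ag mult_mat_zero_vec[OF cA(1)] by simp
      thus False using p by simp
    qed
    hence pos: "g $ p > 0" using cA(3)[OF g] gp by simp
    \<comment> \<open>This is Cauchy-Schwarz for the inner product of \<open>A\<close>: as
      \<open>A g\<close> is the unit vector \<open>p\<close>, the coordinate \<open>x $ p\<close> is
      the product of \<open>x\<close> and \<open>g\<close>, and \<open>s\<close> is the coefficient
      of the projection of \<open>x\<close> onto \<open>g\<close>.\<close>
    define s where "s = x $ p / g $ p"
    have "0 \<le> (x + (- s) \<cdot>\<^sub>v g) \<bullet> (A *\<^sub>v (x + (- s) \<cdot>\<^sub>v g))" using x g by (intro nonneg) auto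
    also have "\<dots> = x \<bullet> (A *\<^sub>v x) + 2 * (- s) * (x \<bullet> (A *\<^sub>v g)) + (- s)\<^sup>2 * (g \<bullet> (A *\<^sub>v g))"
      by (rule quad_form_add_smult[OF cA(1,2) x g])
    also have "\<dots> = x \<bullet> (A *\<^sub>v x) - (x $ p)\<^sup>2 / g $ p"
      unfolding gp unfolding Ag s_def using x p pos by (simp add: power2_eq_square field_simps)
    finally have "(x $ p)\<^sup>2 \<le> g $ p * (x \<bullet> (A *\<^sub>v x))" using pos by (simp add: field_simps)
    also have "\<dots> \<le> C * (x \<bullet> (A *\<^sub>v x))"
    proof (intro mult_right_mono nonneg x)
      have "g $ p \<le> \<bar>H $$ (p, p)\<bar>" unfolding g_def using H p by simp
      also have "\<dots> \<le> C" unfolding C_def using p by (intro member_le_sum) auto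
      finally show "g $ p \<le> C" .
    qed
    finally show ?thesis .
  qed
  moreover have "C \<ge> 0" unfolding C_def by (simp add: sum_nonneg)
  ultimately show thesis using that by blast
qed

text \<open>Tychonoff's theorem on a function type. Matrices are coded below as functions of index
  pairs, so that a box of bounded entries is compact in the product topology.\<close>

lemma compact_PiE_UNIV:
  fixes S :: "'i \<Rightarrow> 'a::topological_space set"
  assumes "\<And>i. compact (S i)"
  shows "compact (PiE UNIV S)"
  using compactin_PiE[of "\<lambda>_. euclidean" UNIV S] assms
  by (simp add: euclidean_product_topology flip: compactin_euclidean_iff)

text \<open>Symplectic matrices whose weighted trace is at most that of the identity have bounded
  entries, by the coordinate bound applied to their columns. They therefore lie in a compact set,
  and a minimiser on it is global because every other symplectic matrix does worse than the
  identity.\<close>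

lemma symplectic_weighted_trace_minimiser:
  fixes c :: "nat \<Rightarrow> real"
  assumes A: "pos_def (2*n) A" and c: "\<And>a. a < 2*n \<Longrightarrow> c a > 0"
  obtains M where "symplectic n M" "\<And>N. symplectic n N \<Longrightarrow>
    (\<Sum>a<2*n. c a * (transpose_mat M * A * M) $$ (a, a)) \<le> (\<Sum>a<2*n. c a * (transpose_mat N * A * N) $$ (a, a))"
proof -
  let ?F = "\<lambda>N. \<Sum>a<2*n. c a * (transpose_mat N * A * N) $$ (a, a)"
  let ?m = "\<lambda>f :: nat \<times> nat \<Rightarrow> real. mat (2*n) (2*n) f"
  note cA = pos_defD(1)[OF A]
  have one: "symplectic n (1\<^sub>m (2*n))" by (rule symplectic_one)
  obtain C where C: "C \<ge> 0" "\<And>x p. x \<in> carrier_vec (2*n) \<Longrightarrow> p < 2*n \<Longrightarrow> (x $ p)\<^sup>2 \<le> C * (x \<bullet> (A *\<^sub>v x))"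
    using pos_def_coord_bound[OF A] by blast
  \<comment> \<open>The sum bounds the square of every entry. The extra 1 turns this into a bound on
    the entry itself through 2|x| <= x^2 + 1, without a square root.\<close>
  define R where "R = 1 + C * (\<Sum>a<2*n. \<bar>?F (1\<^sub>m (2*n))\<bar> / c a)"
  have R: "\<bar>N $$ (p, a)\<bar> \<le> R" if N: "symplectic n N" "?F N \<le> ?F (1\<^sub>m (2*n))" and pa: "p < 2*n" "a < 2*n" for N p a
  proof -
    note cN = symplecticD(1)[OF N(1)]
    have term_nonneg: "c b * (transpose_mat N * A * N) $$ (b, b) \<ge> 0" if "b < 2*n" for b
      using pos_def_diag[OF pos_def_congruence[OF A N(1)] that] c[OF that] by (simp add: less_imp_le)
    have "(N $$ (p, a))\<^sup>2 = (col N a $ p)\<^sup>2" using pa cN by simp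
    also have "\<dots> \<le> C * (col N a \<bullet> (A *\<^sub>v col N a))" using cN pa by (intro C(2)) auto
    also have "col N a \<bullet> (A *\<^sub>v col N a) = (transpose_mat N * A * N) $$ (a, a)"
      using congruence_diag[OF cA cN pa(2)] cN pa(2) by (simp add: mult_mat_unit_vec)
    also have "\<dots> \<le> ?F N / c a"
    proof -
      have "c a * (transpose_mat N * A * N) $$ (a, a) \<le> ?F N"
        using pa term_nonneg by (intro member_le_sum[of a _ "\<lambda>a. c a * (transpose_mat N * A * N) $$ (a, a)"]) auto
      thus ?thesis using c[OF pa(2)] by (simp add: field_simps)
    qed
    also have "\<dots> \<le> \<bar>?F (1\<^sub>m (2*n))\<bar> / c a"
      using N(2) c[OF pa(2)] by (intro divide_right_mono) auto
    also have "\<dots> \<le> (\<Sum>a<2*n. \<bar>?F (1\<^sub>m (2*n))\<bar> / c a)"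
      using pa c by (intro member_le_sum) (auto simp: less_imp_le)
    finally have "(N $$ (p, a))\<^sup>2 \<le> R - 1" unfolding R_def using C(1) by (simp add: mult_left_mono)
    moreover have "2 * \<bar>N $$ (p, a)\<bar> \<le> (N $$ (p, a))\<^sup>2 + 1"
      using zero_le_power2[of "\<bar>N $$ (p, a)\<bar> - 1"] by (simp add: power2_eq_square algebra_simps)
    moreover have "R \<ge> 1" unfolding R_def using C(1) c by (auto intro!: mult_nonneg_nonneg sum_nonneg simp: less_imp_le)
    ultimately show ?thesis by linarith
  qed
  have entry: "(transpose_mat (?m f) * X * ?m f) $$ (a, b) = (\<Sum>i<2*n. \<Sum>j<2*n. f (i, a) * X $$ (i, j) * f (j, b))"
    if "a < 2*n" "b < 2*n" "X \<in> carrier_mat (2*n) (2*n)" for f a b X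
    using congruence_index[OF that(3) mat_carrier that(1,2), of f] that by (simp del: index_mult_mat)
  have cont: "continuous_on UNIV (\<lambda>f :: nat \<times> nat \<Rightarrow> real. f i)" for i by simp
  define K where "K = (PiE UNIV (\<lambda>_. {- R..R})) \<inter> {f. symplectic n (?m f)}"
  \<comment> \<open>The symplectic condition is a finite system of polynomial equations in the
    entries, which gives closedness.\<close>
  have "{f. symplectic n (?m f)} = (\<Inter>a\<in>{..<2*n}. \<Inter>b\<in>{..<2*n}.
      {f. (\<Sum>i<2*n. \<Sum>j<2*n. f (i, a) * J_mat n $$ (i, j) * f (j, b)) = J_mat n $$ (a, b)})"
  proof (intro subset_antisym subsetI)
    fix f assume "f \<in> {f. symplectic n (?m f)}"
    hence "transpose_mat (?m f) * J_mat n * ?m f = J_mat n" unfolding symplectic_def by simp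
    thus "f \<in> (\<Inter>a\<in>{..<2*n}. \<Inter>b\<in>{..<2*n}.
      {f. (\<Sum>i<2*n. \<Sum>j<2*n. f (i, a) * J_mat n $$ (i, j) * f (j, b)) = J_mat n $$ (a, b)})"
      using entry[OF _ _ J_mat_carrier(1), of _ _ f] by (simp del: J_mat_index)
  next
    fix f assume f: "f \<in> (\<Inter>a\<in>{..<2*n}. \<Inter>b\<in>{..<2*n}.
      {f. (\<Sum>i<2*n. \<Sum>j<2*n. f (i, a) * J_mat n $$ (i, j) * f (j, b)) = J_mat n $$ (a, b)})"
    have "transpose_mat (?m f) * J_mat n * ?m f = J_mat n"
    proof (rule eq_matI)
      fix a b assume "a < dim_row (J_mat n)" "b < dim_col (J_mat n)"
      hence ab: "a < 2*n" "b < 2*n" by auto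
      show "(transpose_mat (?m f) * J_mat n * ?m f) $$ (a, b) = J_mat n $$ (a, b)"
        unfolding entry[OF ab J_mat_carrier(1)] using f ab by blast
    qed auto
    thus "f \<in> {f. symplectic n (?m f)}" unfolding symplectic_def by simp
  qed
  hence "closed {f. symplectic n (?m f)}"
    by (auto intro!: closed_INT closed_Collect_eq continuous_on_sum continuous_on_mult cont continuous_on_const)
  hence K: "compact K" unfolding K_def by (intro compact_Int_closed compact_PiE_UNIV) auto
  have "?F (?m f) = (\<Sum>a<2*n. c a * (\<Sum>i<2*n. \<Sum>j<2*n. f (i, a) * A $$ (i, j) * f (j, a)))" for f
    using entry[OF _ _ cA] by (intro sum.cong refl) simp
  hence contF: "continuous_on K (\<lambda>f. ?F (?m f))"
    by (auto intro!: continuous_on_sum continuous_on_mult continuous_on_const continuous_on_subset[OF cont])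
  have in_K: "\<exists>f\<in>K. ?m f = N" if N: "symplectic n N" "?F N \<le> ?F (1\<^sub>m (2*n))" for N
  proof
    \<comment> \<open>The box constrains all index pairs, also those outside the matrix; the default
      0 lies in it because \<open>R\<close> is nonnegative.\<close>
    define f where "f = (\<lambda>(a, b). if a < 2*n \<and> b < 2*n then N $$ (a, b) else 0)"
    show m: "?m f = N" using symplecticD(1)[OF N(1)] by (intro eq_matI) (auto simp: f_def)
    have "0 \<le> R" unfolding R_def using C(1) c by (auto intro!: add_nonneg_nonneg mult_nonneg_nonneg sum_nonneg simp: less_imp_le)
    hence "f i \<in> {- R..R}" for i
      using R[OF N, of "fst i" "snd i"] unfolding f_def by (auto split: prod.splits)
    thus "f \<in> K" unfolding K_def using m N by auto
  qed
  have "K \<noteq> {}" using in_K[OF one] by auto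
  then obtain f where f: "f \<in> K" "\<And>g. g \<in> K \<Longrightarrow> ?F (?m f) \<le> ?F (?m g)"
    using continuous_attains_inf[OF K _ contF] by auto
  show thesis
  proof (rule that)
    show "symplectic n (?m f)" using f(1) unfolding K_def by simp
    fix N assume N: "symplectic n N"
    show "?F (?m f) \<le> ?F N"
    proof (cases "?F N \<le> ?F (1\<^sub>m (2*n))")
      case True
      then obtain g where "g \<in> K" "?m g = N" using in_K[OF N] by blast
      thus ?thesis using f(2)[of g] by simp
    next
      case False
      obtain g where "g \<in> K" "?m g = 1\<^sub>m (2*n)" using in_K[OF one] by blast
      thus ?thesis using f(2)[of g] False by simp
    qed
  qed
qed

text \<open>With pairwise distinct weights, a critical point of the weighted trace
  \<open>\<Sum>\<^sub>j c\<^sub>j (B\<^sub>j\<^sub>j + B\<^sub>n\<^sub>+\<^sub>j\<^sub>,\<^sub>n\<^sub>+\<^sub>j)\<close> on a symplectic orbit is in Williamson normal form.\<close>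

theorem Williamson_exists:
  assumes A: "pos_def (2*n) A"
  shows "\<exists>d. williamson n A d"
proof -
  \<comment> \<open>Equal weights on \<open>i\<close> and \<open>n + i\<close> make the two diagonal
    blocks agree on the diagonal; distinct weights for distinct \<open>i\<close> remove the
    off-diagonal entries. Counting from 1 keeps the weights positive.\<close>
  define c where "c a = real (1 + (if a < n then a else a - n))" for a
  obtain M where M: "symplectic n M" and min: "\<And>N. symplectic n N \<Longrightarrow>
    (\<Sum>a<2*n. c a * (transpose_mat M * A * M) $$ (a, a)) \<le> (\<Sum>a<2*n. c a * (transpose_mat N * A * N) $$ (a, a))"
    using symplectic_weighted_trace_minimiser[OF A, of c] by (auto simp: c_def)
  define B where "B = transpose_mat M * A * M"
  have B: "pos_def (2*n) B" unfolding B_def by (rule pos_def_congruence[OF A M])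
  note cB = pos_defD(1,2)[OF B]
  have minB: "(\<Sum>a<2*n. c a * B $$ (a, a)) \<le> (\<Sum>a<2*n. c a * (transpose_mat S * B * S) $$ (a, a))"
    if S: "symplectic n S" for S
    using min[OF symplectic_mult[OF M S]] pos_defD(1)[OF A] symplecticD(1)[OF M] symplecticD(1)[OF S]
    unfolding B_def by (simp only: congruence_assoc)
  have skew: "c p * (B * J_mat n) $$ (p, q) = - (c q * (B * J_mat n) $$ (q, p))"
    if "p < 2*n" "q < 2*n" for p q
    by (rule weighted_trace_stationary_skew[OF cB minB that])
  have BJ: "(B * J_mat n) $$ (a, b) = (if b < n then - B $$ (a, b + n) else B $$ (a, b - n))"
    if "a < 2*n" "b < 2*n" for a b
    using mult_J_mat_index[OF cB(1) that] .
  have sym: "B $$ (a, b) = B $$ (b, a)" if "a < 2*n" "b < 2*n" for a b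
    using pos_def_symmetric[OF B that] .
  have blocks: "B $$ (i, n + j) = 0" "i \<noteq> j \<Longrightarrow> B $$ (i, j) = 0 \<and> B $$ (n + i, n + j) = 0"
    "B $$ (i, i) = B $$ (n + i, n + i)" if ij: "i < n" "j < n" for i j
  proof -
    define x where "x = real (Suc i)"
    define y where "y = real (Suc j)"
    have xy: "x > 0" "y > 0" "i \<noteq> j \<Longrightarrow> x * x \<noteq> y * y" unfolding x_def y_def
      by (auto simp: power2_eq_square[symmetric] simp del: of_nat_Suc)
    have cs: "c i = x" "c j = y" "c (n + i) = x" "c (n + j) = y"
      unfolding c_def x_def y_def using ij by auto
    have lt: "i < 2*n" "j < 2*n" "n + i < 2*n" "n + j < 2*n" using ij by auto
    have Q: "x * B $$ (i, n + j) = - (y * B $$ (j, n + i))" "x * B $$ (j, n + i) = - (y * B $$ (i, n + j))"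
      using skew[OF lt(1,2)] skew[OF lt(3,4)] lt ij sym[OF lt(3,2)] sym[OF lt(4,1)]
      unfolding cs by (auto simp: BJ add.commute simp del: index_mult_mat)
    have P: "x * B $$ (i, j) = y * B $$ (n + i, n + j)" "y * B $$ (i, j) = x * B $$ (n + i, n + j)"
      using skew[OF lt(1,4)] skew[OF lt(2,3)] lt ij sym[OF lt(1,2)] sym[OF lt(3,4)]
      unfolding cs by (auto simp: BJ add.commute simp del: index_mult_mat)
    \<comment> \<open>Both systems \<open>Q\<close> and \<open>P\<close> have this shape.
      Substituting one equation into the other gives (x^2 - y^2) u = 0, and distinct positive
      weights have distinct squares.\<close>
    have elim: "u = 0" if "x * u = y * v" "y * u = x * v" "i \<noteq> j" for u v :: real
    proof -
      have "x * (x * u) = y * (y * u)" unfolding that(1,2) by (simp add: mult.left_commute)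
      hence "(x * x - y * y) * u = 0" by (simp add: algebra_simps)
      thus ?thesis using xy(3)[OF that(3)] by simp
    qed
    show "B $$ (i, n + j) = 0"
    proof (cases "i = j")
      case True
      thus ?thesis using Q(1) xy unfolding x_def y_def by (simp del: of_nat_Suc)
    next
      case False
      show ?thesis using elim[of "B $$ (i, n + j)" "- B $$ (j, n + i)"] Q False by simp
    qed
    show "B $$ (i, j) = 0 \<and> B $$ (n + i, n + j) = 0" if "i \<noteq> j"
      using elim[OF P that] P xy by simp
    have "c i * (B * J_mat n) $$ (i, n + i) = - (c (n + i) * (B * J_mat n) $$ (n + i, i))"
      by (rule skew[OF lt(1,3)])
    thus "B $$ (i, i) = B $$ (n + i, n + i)"
      using lt ij xy unfolding cs by (auto simp: BJ add.commute simp del: index_mult_mat)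
  qed
  define d where "d = map (\<lambda>i. B $$ (i, i)) [0..<n]"
  have len: "length d = n" and d_nth: "\<And>i. i < n \<Longrightarrow> d ! i = B $$ (i, i)" unfolding d_def by simp_all
  have "B = diag_double d"
  proof (rule eq_matI)
    show "dim_row B = dim_row (diag_double d)" "dim_col B = dim_col (diag_double d)"
      using cB(1) diag_double_carrier[OF len] by auto
    fix a b assume "a < dim_row (diag_double d)" "b < dim_col (diag_double d)"
    hence ab: "a < 2*n" "b < 2*n" using diag_double_carrier[OF len] by auto
    consider "a < n" "b < n" | j where "a < n" "j < n" "b = n + j" | i where "i < n" "a = n + i" "b < n"
      | i j where "i < n" "j < n" "a = n + i" "b = n + j"
      using ab by (metis add_diff_inverse_nat add_less_cancel_left mult_2)
    thus "B $$ (a, b) = diag_double d $$ (a, b)"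
    proof cases
      case 1
      thus ?thesis using blocks(2)[of a b] ab by (auto simp: diag_double_index[OF len] d_nth)
    next
      case 2
      thus ?thesis using blocks(1)[of a j] ab by (auto simp: diag_double_index[OF len])
    next
      case 3
      thus ?thesis using blocks(1)[of b i] sym[OF ab] ab by (auto simp: diag_double_index[OF len])
    next
      case 4
      thus ?thesis using blocks(2)[of i j] blocks(3)[of i i] ab by (auto simp: diag_double_index[OF len] d_nth)
    qed
  qed
  moreover have "\<forall>x\<in>set d. x > 0" unfolding d_def using pos_def_diag[OF B] by auto
  ultimately show ?thesis using M len unfolding williamson_iff B_def by blast
qed

section \<open>Permuting the coordinate planes\<close>

definition perm_double :: "nat \<Rightarrow> (nat \<Rightarrow> nat) \<Rightarrow> nat \<Rightarrow> nat" where
  "perm_double n f b = (if b < n then f b else n + f (b - n))"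

lemma perm_double_simps [simp]:
  "i < n \<Longrightarrow> perm_double n f i = f i" "perm_double n f (n + i) = n + f i"
  unfolding perm_double_def by auto

lemma double_index_cases:
  assumes "a < 2 * n"
  obtains "a < n" | i where "i < n" "a = n + (i::nat)"
  using assms by (metis add_diff_inverse_nat add_less_cancel_left mult_2)

text \<open>Acting alike on both halves, the permutation respects the pairing of \<open>i\<close>
  with \<open>n + i\<close> and so fixes \<open>J_mat n\<close> entrywise. The entry formula holds
  for every \<open>X\<close>, as it is applied to \<open>J_mat n\<close>, to normal forms and to the
  matrices carrying the means.\<close>

lemma symplectic_permutation:
  assumes f: "bij_betw f {..<n} {..<n}"
  obtains S where "symplectic n S"
    "\<And>X a b. X \<in> carrier_mat (2*n) (2*n) \<Longrightarrow> a < 2*n \<Longrightarrow> b < 2*n \<Longrightarrow>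
      (transpose_mat S * X * S) $$ (a, b) = X $$ (perm_double n f a, perm_double n f b)"
proof -
  let ?s = "perm_double n f"
  define S where "S = mat (2*n) (2*n) (\<lambda>(a, b). if a = ?s b then 1 else 0 :: real)"
  have S: "S \<in> carrier_mat (2*n) (2*n)" unfolding S_def by auto
  have fn: "f i < n" if "i < n" for i using bij_betwE[OF f] that by auto
  have finj: "f i = f j \<longleftrightarrow> i = j" if "i < n" "j < n" for i j
    using f that by (auto simp: bij_betw_def inj_on_def)
  have sn: "?s b < 2*n" if "b < 2*n" for b
    using fn[of b] fn[of "b - n"] that unfolding perm_double_def by auto
  have congr: "(transpose_mat S * X * S) $$ (a, b) = X $$ (?s a, ?s b)"
    if X: "X \<in> carrier_mat (2*n) (2*n)" and ab: "a < 2*n" "b < 2*n" for X a b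
  proof -
    have "(transpose_mat S * X * S) $$ (a, b) = (\<Sum>c<2*n. \<Sum>d<2*n. S $$ (c, a) * X $$ (c, d) * S $$ (d, b))"
      by (rule congruence_index[OF X S ab])
    also have "\<dots> = (\<Sum>c<2*n. \<Sum>d<2*n. if d = ?s b then (if c = ?s a then X $$ (?s a, ?s b) else 0) else 0)"
      using ab by (intro sum.cong refl) (auto simp: S_def)
    also have "\<dots> = X $$ (?s a, ?s b)" using sn[OF ab(1)] sn[OF ab(2)] by simp
    finally show ?thesis .
  qed
  have "transpose_mat S * J_mat n * S = J_mat n"
  proof (rule eq_matI)
    fix a b assume "a < dim_row (J_mat n)" "b < dim_col (J_mat n)"
    hence ab: "a < 2*n" "b < 2*n" by auto
    have "J_mat n $$ (?s a, ?s b) = J_mat n $$ (a, b)"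
    proof (rule double_index_cases[OF ab(1)]; rule double_index_cases[OF ab(2)])
      assume "a < n" "b < n"
      thus ?thesis using fn[of a] fn[of b] by simp
    next
      fix j assume "a < n" "j < n" "b = n + j"
      thus ?thesis using fn[of a] fn[of j] finj[of a j] by auto
    next
      fix i assume "i < n" "a = n + i" "b < n"
      thus ?thesis using fn[of i] fn[of b] finj[of i b] by auto
    next
      fix i j assume "i < n" "a = n + i" "j < n" "b = n + j"
      thus ?thesis using fn[of i] fn[of j] by simp
    qed
    thus "(transpose_mat S * J_mat n * S) $$ (a, b) = J_mat n $$ (a, b)"
      unfolding congr[OF J_mat_carrier(1) ab] .
  qed (use S in auto)
  hence "symplectic n S" using S unfolding symplectic_def by simp
  thus thesis using that congr by blast
qed

text \<open>The minimiser yields the diagonal in an order that is not controlled, whereas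
  \<open>sympl_eigvals\<close> requires a sorted list.\<close>

lemma williamson_sort:
  assumes W: "williamson n A d" and A: "A \<in> carrier_mat (2*n) (2*n)"
  shows "williamson n A (sort d)"
proof -
  obtain M where M: "symplectic n M" "transpose_mat M * A * M = diag_double d" and len: "length d = n"
    and pos: "\<forall>x\<in>set d. x > 0"
    using W unfolding williamson_iff by auto
  obtain f where f: "bij_betw f {..<n} {..<n}" "\<And>i. i < n \<Longrightarrow> sort d ! i = d ! f i"
    using sort_bij_nth[of d] len by auto
  obtain S where S: "symplectic n S"
    "\<And>X a b. X \<in> carrier_mat (2*n) (2*n) \<Longrightarrow> a < 2*n \<Longrightarrow> b < 2*n \<Longrightarrow>
      (transpose_mat S * X * S) $$ (a, b) = X $$ (perm_double n f a, perm_double n f b)"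
    using symplectic_permutation[OF f(1)] by blast
  note c = symplecticD(1)[OF M(1)] symplecticD(1)[OF S(1)] diag_double_carrier[OF len] diag_double_carrier[of "sort d" n]
  have fn: "f i < n" if "i < n" for i using bij_betwE[OF f(1)] that by auto
  have finj: "f i = f j \<longleftrightarrow> i = j" if "i < n" "j < n" for i j
    using f that by (auto simp: bij_betw_def inj_on_def)
  have "transpose_mat (M * S) * A * (M * S) = transpose_mat S * diag_double d * S"
    using congruence_assoc[OF A c(1,2)] M(2) by simp
  also have "\<dots> = diag_double (sort d)"
  proof (rule eq_matI)
    fix a b assume "a < dim_row (diag_double (sort d))" "b < dim_col (diag_double (sort d))"
    hence ab: "a < 2*n" "b < 2*n" using c len by auto
    have "diag_double d $$ (perm_double n f a, perm_double n f b) = diag_double (sort d) $$ (a, b)"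
    proof (rule double_index_cases[OF ab(1)]; rule double_index_cases[OF ab(2)])
      assume "a < n" "b < n"
      thus ?thesis using fn[of a] fn[of b] finj[of a b] len by (simp add: diag_double_index[of _ n] f(2))
    next
      fix j assume "a < n" "j < n" "b = n + j"
      thus ?thesis using fn[of a] fn[of j] len by (simp add: diag_double_index[of _ n])
    next
      fix i assume "i < n" "a = n + i" "b < n"
      thus ?thesis using fn[of i] fn[of b] len by (simp add: diag_double_index[of _ n])
    next
      fix i j assume "i < n" "a = n + i" "j < n" "b = n + j"
      thus ?thesis using fn[of i] fn[of j] finj[of i j] len by (simp add: diag_double_index[of _ n] f(2))
    qed
    thus "(transpose_mat S * diag_double d * S) $$ (a, b) = diag_double (sort d) $$ (a, b)"
      unfolding S(2)[OF c(3) ab] .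
  qed (use c len in auto)
  finally show ?thesis using symplectic_mult[OF M(1) S(1)] len pos unfolding williamson_iff by auto
qed

lemma sympl_eigvals_williamson:
  assumes "pos_def (2*n) A"
  shows "williamson n A (sympl_eigvals n A)" "sorted (sympl_eigvals n A)"
proof -
  obtain d where "williamson n A d" using Williamson_exists[OF assms] by blast
  hence "williamson n A (sort d)" using williamson_sort pos_defD(1)[OF assms] by blast
  hence "sympl_eigvals n A = sort d" "williamson n A (sort d)"
    using sympl_eigvals_eqI pos_defD(1)[OF assms] by auto
  thus "williamson n A (sympl_eigvals n A)" "sorted (sympl_eigvals n A)" by simp_all
qed

section \<open>Attaining prescribed means\<close>

lemma diag_double_pos_def:
  assumes len: "length d = n" and pos: "\<forall>x\<in>set d. x > 0"
  shows "pos_def (2*n) (diag_double d)"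
  unfolding pos_def_def
proof (intro conjI ballI impI)
  note D = diag_double_carrier[OF len]
  show "diag_double d \<in> carrier_mat (2*n) (2*n)" by (rule D)
  show "transpose_mat (diag_double d) = diag_double d"
    using D by (intro eq_matI) (auto simp: diag_double_index[OF len])
  fix v :: "real vec" assume v: "v \<in> carrier_vec (2*n)" "v \<noteq> 0\<^sub>v (2*n)"
  define e where "e a = d ! (if a < n then a else a - n)" for a
  have e: "e a > 0" if "a < 2*n" for a using that pos len unfolding e_def by auto
  have Dv: "(diag_double d *\<^sub>v v) $ a = e a * v $ a" if a: "a < 2*n" for a
  proof -
    have "(diag_double d *\<^sub>v v) $ a = (\<Sum>b<2*n. diag_double d $$ (a, b) * v $ b)"
      using a D v by (simp add: scalar_prod_def atLeast0LessThan)
    also have "\<dots> = (\<Sum>b<2*n. if b = a then e a * v $ a else 0)"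
      using a by (intro sum.cong refl) (auto simp: diag_double_index[OF len] e_def)
    finally show ?thesis using a by simp
  qed
  have "v \<bullet> (diag_double d *\<^sub>v v) = (\<Sum>a<2*n. v $ a * (diag_double d *\<^sub>v v) $ a)"
    using D v by (simp add: scalar_prod_def atLeast0LessThan del: index_mult_mat_vec)
  also have "\<dots> = (\<Sum>a<2*n. e a * (v $ a)\<^sup>2)"
    by (intro sum.cong refl) (simp add: Dv power2_eq_square del: index_mult_mat_vec)
  also have "\<dots> > 0"
  proof -
    obtain a where a: "a < 2*n" "v $ a \<noteq> 0" using v by (metis carrier_vecD eq_vecI index_zero_vec)
    have "0 < e a * (v $ a)\<^sup>2" using e[OF a(1)] a(2) by simp
    also have "\<dots> \<le> (\<Sum>a<2*n. e a * (v $ a)\<^sup>2)"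
      using a e by (intro member_le_sum[of a _ "\<lambda>a. e a * (v $ a)\<^sup>2"]) (auto simp: less_imp_le)
    finally show ?thesis .
  qed
  finally show "0 < v \<bullet> (diag_double d *\<^sub>v v)" .
qed

lemma diag_double_williamson:
  assumes "length d = n" "\<forall>x\<in>set d. x > 0"
  shows "williamson n (diag_double d) d"
  unfolding williamson_iff using assms diag_double_carrier[OF assms(1)]
  by (auto intro!: exI[of _ "1\<^sub>m (2*n)"] symplectic_one)

text \<open>The hypothesis makes \<open>Y\<close> the inverse transpose of \<open>X\<close>. Both
  later moves have this form: a rotation \<open>X\<close> with \<open>Y = X\<close>, and a diagonal
  scaling paired with its reciprocal.\<close>

lemma symplectic_block_diag:
  fixes X Y :: "real mat"
  assumes X: "X \<in> carrier_mat n n" and Y: "Y \<in> carrier_mat n n" and XY: "transpose_mat X * Y = 1\<^sub>m n"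
  shows "symplectic n (four_block_mat X (0\<^sub>m n n) (0\<^sub>m n n) Y)"
proof -
  have YX: "transpose_mat Y * X = 1\<^sub>m n"
    using transpose_mult[of "transpose_mat X" n n Y n] X Y XY by simp
  let ?S = "four_block_mat X (0\<^sub>m n n) (0\<^sub>m n n) Y"
  have "transpose_mat ?S = four_block_mat (transpose_mat X) (0\<^sub>m n n) (0\<^sub>m n n) (transpose_mat Y)"
    using X Y by (subst transpose_four_block_mat[of _ n n _ n _ n]) auto
  moreover have "\<dots> * J_mat n = four_block_mat (0\<^sub>m n n) (transpose_mat X) (- transpose_mat Y) (0\<^sub>m n n)"
    unfolding J_mat_def using X Y
    by (subst mult_four_block_mat[of _ n n _ n _ n _ _ n _ n]) auto
  moreover have "\<dots> * ?S = J_mat n"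
    unfolding J_mat_def using X Y
    by (subst mult_four_block_mat[of _ n n _ n _ n _ _ n _ n]) (auto simp: XY YX)
  ultimately show ?thesis unfolding symplectic_def using X Y by (auto simp: mult_2)
qed

section \<open>Squeezes and rotations of coordinate planes\<close>

lemma congruence_diag_two:
  fixes A S :: "real mat"
  assumes A: "A \<in> carrier_mat m m" and S: "S \<in> carrier_mat m m" and apq: "a < m" "p < m" "q < m"
    and col: "col S a = \<alpha> \<cdot>\<^sub>v unit_vec m p + \<beta> \<cdot>\<^sub>v unit_vec m q"
  shows "(transpose_mat S * A * S) $$ (a, a) =
    \<alpha>\<^sup>2 * A $$ (p, p) + \<alpha> * \<beta> * (A $$ (p, q) + A $$ (q, p)) + \<beta>\<^sup>2 * A $$ (q, q)"
proof -
  have 1: "A *\<^sub>v (\<alpha> \<cdot>\<^sub>v unit_vec m p + \<beta> \<cdot>\<^sub>v unit_vec m q) = \<alpha> \<cdot>\<^sub>v col A p + \<beta> \<cdot>\<^sub>v col A q"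
    using A apq by (simp add: mult_add_distrib_mat_vec[of _ m m] mult_mat_vec[of _ m m] mult_mat_unit_vec)
  have "(transpose_mat S * A * S) $$ (a, a) = col S a \<bullet> (A *\<^sub>v col S a)"
    using congruence_diag[OF A S apq(1)] S apq by (simp add: mult_mat_unit_vec)
  also have "\<dots> = (\<alpha> \<cdot>\<^sub>v unit_vec m p + \<beta> \<cdot>\<^sub>v unit_vec m q) \<bullet> (\<alpha> \<cdot>\<^sub>v col A p + \<beta> \<cdot>\<^sub>v col A q)"
    unfolding col 1 ..
  also have "\<dots> = \<alpha>\<^sup>2 * A $$ (p, p) + \<alpha> * \<beta> * (A $$ (p, q) + A $$ (q, p)) + \<beta>\<^sup>2 * A $$ (q, q)"
    using A apq by (simp add: add_scalar_prod_distrib[of _ m] power2_eq_square algebra_simps)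
  finally show ?thesis .
qed

text \<open>The means form a function and not a list, so that the moves become function updates;
  only its values below \<open>n\<close> are constrained.\<close>

definition attains_means :: "nat \<Rightarrow> real list \<Rightarrow> (nat \<Rightarrow> real) \<Rightarrow> bool" where
  "attains_means n d z \<longleftrightarrow> (\<exists>A. pos_def (2*n) A \<and> williamson n A d \<and>
    (\<forall>j<n. (A $$ (j, j) + A $$ (n + j, n + j)) / 2 = z j))"

lemma attains_means_congruence:
  assumes "pos_def (2*n) A" "williamson n A d" "symplectic n S"
    "\<And>j. j < n \<Longrightarrow> ((transpose_mat S * A * S) $$ (j, j) + (transpose_mat S * A * S) $$ (n + j, n + j)) / 2 = z j"
  shows "attains_means n d z"
  unfolding attains_means_def
  using assms(4) pos_def_congruence[OF assms(1,3)] williamson_congruence[OF assms(2) pos_defD(1)[OF assms(1)] assms(3)]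
  by blast

text \<open>Squeezing by \<open>t\<close> and \<open>1 / t\<close> turns the mean of
  \<open>p\<close> and \<open>q\<close> into that of t^2 p and q / t^2. It starts at
  \<open>z i\<close> for \<open>t = 1\<close> and grows without bound, so it takes the value
  \<open>s\<close>.\<close>

lemma attains_means_raise:
  assumes z: "attains_means n d z" and i: "i < n" and s: "z i \<le> s"
  shows "attains_means n d (z(i := s))"
proof -
  obtain A where A: "pos_def (2*n) A" "williamson n A d"
    and Az: "\<And>j. j < n \<Longrightarrow> (A $$ (j, j) + A $$ (n + j, n + j)) / 2 = z j"
    using z unfolding attains_means_def by auto
  note cA = pos_defD(1)[OF A(1)]
  define p where "p = A $$ (i, i)"
  define q where "q = A $$ (n + i, n + i)"
  have pq: "p > 0" "q > 0" "(p + q) / 2 = z i"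
    unfolding p_def q_def using pos_def_diag[OF A(1)] i Az by auto
  \<comment> \<open>Chosen so that \<open>T * p\<close> exceeds \<open>2 * s\<close>; since
    \<open>T\<close> is at least 1, the first summand alone then takes the mean past
    \<open>s\<close>.\<close>
  define T where "T = 1 + 2 * s / p"
  have "z i > 0" unfolding pq(3)[symmetric] using pq(1,2) by simp
  hence s0: "s > 0" using s by simp
  have T: "T \<ge> 1" unfolding T_def using s0 pq by simp
  have "\<exists>t\<ge>1. t \<le> T \<and> (t\<^sup>2 * p + (1 / t)\<^sup>2 * q) / 2 = s"
  proof (rule IVT')
    show "(1\<^sup>2 * p + (1 / 1)\<^sup>2 * q) / 2 \<le> s" using pq s by simp
    have "2 * s \<le> T * p" unfolding T_def using pq by (simp add: field_simps)
    also have "\<dots> \<le> T\<^sup>2 * p" using T pq by (intro mult_right_mono) (auto simp: power2_eq_square)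
    also have "\<dots> \<le> T\<^sup>2 * p + (1 / T)\<^sup>2 * q" using pq by simp
    finally show "s \<le> (T\<^sup>2 * p + (1 / T)\<^sup>2 * q) / 2" by simp
    show "continuous_on {1..T} (\<lambda>t. (t\<^sup>2 * p + (1 / t)\<^sup>2 * q) / 2)"
      by (intro continuous_intros) auto
  qed (rule T)
  then obtain t where t: "t \<ge> 1" "(t\<^sup>2 * p + (1 / t)\<^sup>2 * q) / 2 = s" by auto
  define D where "D u = mat n n (\<lambda>(a, b). if a = b then if a = i then u else 1 else 0 :: real)" for u
  have D: "D u \<in> carrier_mat n n" for u unfolding D_def by auto
  have "transpose_mat (D t) * D (1 / t) = 1\<^sub>m n"
  proof (rule eq_matI)
    fix a b assume "a < dim_row (1\<^sub>m n :: real mat)" "b < dim_col (1\<^sub>m n :: real mat)"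
    hence ab: "a < n" "b < n" by auto
    have "(transpose_mat (D t) * D (1 / t)) $$ (a, b) = (\<Sum>c<n. D t $$ (c, a) * D (1 / t) $$ (c, b))"
      using ab D[of t] D[of "1 / t"] by (simp add: scalar_prod_def atLeast0LessThan)
    also have "\<dots> = (\<Sum>c<n. if c = a then (if a = b then 1 else 0) else 0)"
      using ab t by (intro sum.cong refl) (auto simp: D_def)
    finally show "(transpose_mat (D t) * D (1 / t)) $$ (a, b) = 1\<^sub>m n $$ (a, b)" using ab by simp
  qed (use D[of t] D[of "1 / t"] in auto)
  hence S: "symplectic n (four_block_mat (D t) (0\<^sub>m n n) (0\<^sub>m n n) (D (1 / t)))" (is "symplectic n ?S")
    using D by (intro symplectic_block_diag) auto
  have diag1: "(transpose_mat ?S * A * ?S) $$ (j, j) = (if j = i then t else 1)\<^sup>2 * A $$ (j, j)" if j: "j < n" for j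
  proof -
    have "col ?S j = (if j = i then t else 1) \<cdot>\<^sub>v unit_vec (2*n) j + 0 \<cdot>\<^sub>v unit_vec (2*n) j"
      using j D[of t] D[of "1 / t"] by (intro eq_vecI) (auto simp: D_def)
    from congruence_diag_two[OF cA symplecticD(1)[OF S] _ _ _ this] j show ?thesis by simp
  qed
  have diag2: "(transpose_mat ?S * A * ?S) $$ (n + j, n + j) = (if j = i then 1 / t else 1)\<^sup>2 * A $$ (n + j, n + j)"
    if j: "j < n" for j
  proof -
    have "col ?S (n + j) = (if j = i then 1 / t else 1) \<cdot>\<^sub>v unit_vec (2*n) (n + j) + 0 \<cdot>\<^sub>v unit_vec (2*n) (n + j)"
      using j D[of t] D[of "1 / t"] by (intro eq_vecI) (auto simp: D_def)
    from congruence_diag_two[OF cA symplecticD(1)[OF S] _ _ _ this] j show ?thesis by simp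
  qed
  show ?thesis
    using t(2) Az by (intro attains_means_congruence[OF A S]) (auto simp: diag1 diag2 p_def q_def simp del: index_mult_mat)
qed

text \<open>Rotating both planes by the same angle moves the mean at \<open>i\<close> continuously
  from \<open>z i\<close> at 0 to \<open>z l\<close> at a quarter turn. The intermediate value
  theorem finds the angle despite the cross term \<open>h\<close>, and the mean at \<open>l\<close>
  follows because the rotation preserves their sum.\<close>

lemma attains_means_transfer:
  assumes z: "attains_means n d z" and il: "i < n" "l < n" "i \<noteq> l" and s: "z i \<le> s" "s \<le> z l"
  shows "attains_means n d (z(i := s, l := z i + z l - s))"
proof -
  obtain A where A: "pos_def (2*n) A" "williamson n A d"
    and Az: "\<And>j. j < n \<Longrightarrow> (A $$ (j, j) + A $$ (n + j, n + j)) / 2 = z j"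
    using z unfolding attains_means_def by auto
  note cA = pos_defD(1)[OF A(1)]
  define h where "h = (A $$ (i, l) + A $$ (l, i) + A $$ (n + i, n + l) + A $$ (n + l, n + i)) / 2"
  have "\<exists>\<theta>\<ge>0. \<theta> \<le> pi / 2 \<and> (cos \<theta>)\<^sup>2 * z i + cos \<theta> * sin \<theta> * h + (sin \<theta>)\<^sup>2 * z l = s"
    by (rule IVT') (use s in \<open>auto intro!: continuous_intros\<close>)
  then obtain \<theta> where \<theta>: "(cos \<theta>)\<^sup>2 * z i + cos \<theta> * sin \<theta> * h + (sin \<theta>)\<^sup>2 * z l = s" by auto
  define c where "c = cos \<theta>"
  define r where "r = sin \<theta>"
  have cr: "c\<^sup>2 + r\<^sup>2 = 1" unfolding c_def r_def by simp
  have s_eq: "c\<^sup>2 * z i + c * r * h + r\<^sup>2 * z l = s" using \<theta> unfolding c_def r_def .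
  define X where "X = mat n n (\<lambda>(a, b). if b = i then (if a = i then c else if a = l then r else 0)
     else if b = l then (if a = i then - r else if a = l then c else 0) else if a = b then 1 else 0)"
  have X: "X \<in> carrier_mat n n" unfolding X_def by auto
  have colX: "col X i = c \<cdot>\<^sub>v unit_vec n i + r \<cdot>\<^sub>v unit_vec n l"
    "col X l = (- r) \<cdot>\<^sub>v unit_vec n i + c \<cdot>\<^sub>v unit_vec n l"
    "\<And>j. j < n \<Longrightarrow> j \<noteq> i \<Longrightarrow> j \<noteq> l \<Longrightarrow> col X j = unit_vec n j"
    using il by (auto intro!: eq_vecI simp: X_def)
  have "transpose_mat X * X = 1\<^sub>m n"
  proof (rule eq_matI)
    fix a b assume "a < dim_row (1\<^sub>m n :: real mat)" "b < dim_col (1\<^sub>m n :: real mat)"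
    hence ab: "a < n" "b < n" by auto
    have "(transpose_mat X * X) $$ (a, b) = col X a \<bullet> col X b" using ab X by simp
    also have "\<dots> = (if a = b then 1 else 0)"
      using ab il cr
      by (cases "a = i"; cases "a = l"; cases "b = i"; cases "b = l")
        (auto simp: colX add_scalar_prod_distrib[of _ n] power2_eq_square)
    finally show "(transpose_mat X * X) $$ (a, b) = 1\<^sub>m n $$ (a, b)" using ab by simp
  qed (use X in auto)
  hence S: "symplectic n (four_block_mat X (0\<^sub>m n n) (0\<^sub>m n n) X)" (is "symplectic n ?S")
    using X by (intro symplectic_block_diag) auto
  note diag = congruence_diag_two[OF cA symplecticD(1)[OF S]]
  have "col ?S i = c \<cdot>\<^sub>v unit_vec (2*n) i + r \<cdot>\<^sub>v unit_vec (2*n) l"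
    "col ?S (n + i) = c \<cdot>\<^sub>v unit_vec (2*n) (n + i) + r \<cdot>\<^sub>v unit_vec (2*n) (n + l)"
    "col ?S l = (- r) \<cdot>\<^sub>v unit_vec (2*n) i + c \<cdot>\<^sub>v unit_vec (2*n) l"
    "col ?S (n + l) = (- r) \<cdot>\<^sub>v unit_vec (2*n) (n + i) + c \<cdot>\<^sub>v unit_vec (2*n) (n + l)"
    using il by (auto intro!: eq_vecI simp: X_def)
  note diag_il = diag[OF _ _ _ this(1)] diag[OF _ _ _ this(2)] diag[OF _ _ _ this(3)] diag[OF _ _ _ this(4)]
  have diag_other: "(transpose_mat ?S * A * ?S) $$ (j, j) = A $$ (j, j)"
    "(transpose_mat ?S * A * ?S) $$ (n + j, n + j) = A $$ (n + j, n + j)" if j: "j < n" "j \<noteq> i" "j \<noteq> l" for j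
  proof -
    have "col ?S j = 1 \<cdot>\<^sub>v unit_vec (2*n) j + 0 \<cdot>\<^sub>v unit_vec (2*n) j"
      "col ?S (n + j) = 1 \<cdot>\<^sub>v unit_vec (2*n) (n + j) + 0 \<cdot>\<^sub>v unit_vec (2*n) (n + j)"
      using j by (auto intro!: eq_vecI simp: X_def)
    from diag[OF _ _ _ this(1)] diag[OF _ _ _ this(2)] j
    show "(transpose_mat ?S * A * ?S) $$ (j, j) = A $$ (j, j)"
      "(transpose_mat ?S * A * ?S) $$ (n + j, n + j) = A $$ (n + j, n + j)" by simp_all
  qed
  show ?thesis
  proof (rule attains_means_congruence[OF A S])
    fix j assume j: "j < n"
    let ?B = "transpose_mat ?S * A * ?S"
    have lt: "i < 2*n" "l < 2*n" "n + i < 2*n" "n + l < 2*n" using il by auto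
    have Bi: "(?B $$ (i, i) + ?B $$ (n + i, n + i)) / 2 = s"
      unfolding diag_il(1)[OF lt(1,1,2)] diag_il(2)[OF lt(3,3,4)] s_eq[symmetric] h_def Az[OF il(1), symmetric] Az[OF il(2), symmetric]
      by (simp add: field_simps)
    have "(?B $$ (l, l) + ?B $$ (n + l, n + l)) / 2 = r\<^sup>2 * z i - c * r * h + c\<^sup>2 * z l"
      unfolding diag_il(3)[OF lt(2,1,2)] diag_il(4)[OF lt(4,3,4)] h_def Az[OF il(1), symmetric] Az[OF il(2), symmetric]
      by (simp add: field_simps)
    also have "\<dots> = (c\<^sup>2 + r\<^sup>2) * (z i + z l) - s"
      unfolding s_eq[symmetric] by (simp add: algebra_simps)
    finally have Bl: "(?B $$ (l, l) + ?B $$ (n + l, n + l)) / 2 = z i + z l - s" unfolding cr by simp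
    show "(?B $$ (j, j) + ?B $$ (n + j, n + j)) / 2 = (z(i := s, l := z i + z l - s)) j"
      using Bi Bl diag_other[OF j] Az[OF j] il by (cases "j = i"; cases "j = l") (simp_all del: index_mult_mat)
  qed
qed

lemma attains_means_permute:
  assumes z: "attains_means n d z" and f: "bij_betw f {..<n} {..<n}"
  shows "attains_means n d (\<lambda>j. z (f j))"
proof -
  obtain A where A: "pos_def (2*n) A" "williamson n A d"
    and Az: "\<And>j. j < n \<Longrightarrow> (A $$ (j, j) + A $$ (n + j, n + j)) / 2 = z j"
    using z unfolding attains_means_def by auto
  obtain S where S: "symplectic n S"
    "\<And>X a b. X \<in> carrier_mat (2*n) (2*n) \<Longrightarrow> a < 2*n \<Longrightarrow> b < 2*n \<Longrightarrow>
      (transpose_mat S * X * S) $$ (a, b) = X $$ (perm_double n f a, perm_double n f b)"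
    using symplectic_permutation[OF f] by blast
  have "f j < n" if "j < n" for j using bij_betwE[OF f] that by auto
  thus ?thesis
    using Az by (intro attains_means_congruence[OF A S(1)])
      (simp add: S(2)[OF pos_defD(1)[OF A(1)]] del: index_mult_mat)
qed

text \<open>Induction on the number of indices where \<open>y\<close> and \<open>x\<close> differ.
  Without any excess of \<open>y\<close> over \<open>x\<close> a deficit is filled by
  \<open>raise\<close>; otherwise \<open>transfer\<close> moves mass from an excess to an earlier
  deficit until one of them is gone. The invariant concerns prefix sums of \<open>y\<close> in its
  given order, so \<open>y\<close> need not stay sorted.\<close>

lemma weak_supmaj_induct:
  fixes x y :: "nat \<Rightarrow> real"
  assumes mono: "\<And>i j. i \<le> j \<Longrightarrow> j < n \<Longrightarrow> x i \<le> x j"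
    and raise: "\<And>z i s. Q z \<Longrightarrow> i < n \<Longrightarrow> z i \<le> s \<Longrightarrow> Q (z(i := s))"
    and transfer: "\<And>z i l s. Q z \<Longrightarrow> i < n \<Longrightarrow> l < n \<Longrightarrow> i \<noteq> l \<Longrightarrow> z i \<le> s \<Longrightarrow> s \<le> z l \<Longrightarrow>
      Q (z(i := s, l := z i + z l - s))"
    and "Q y" and "\<And>k. k \<le> n \<Longrightarrow> (\<Sum>i<k. y i) \<le> (\<Sum>i<k. x i)"
  shows "\<exists>z. Q z \<and> (\<forall>i<n. z i = x i)"
  using assms(4,5)
proof (induction "card {i. i < n \<and> y i \<noteq> x i}" arbitrary: y rule: less_induct)
  case less
  note Qy = less.prems(1) and sums = less.prems(2)
  consider "\<forall>i<n. y i = x i" | i where "i < n" "y i < x i" "\<forall>l<n. y l \<le> x l" | l where "l < n" "x l < y l"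
    by (metis linorder_neqE_linordered_idom not_le)
  thus ?case
  proof cases
    case 1
    thus ?thesis using Qy by blast
  next
    case 2
    let ?y = "y(i := x i)"
    have "{j. j < n \<and> ?y j \<noteq> x j} \<subset> {j. j < n \<and> y j \<noteq> x j}" using 2 by auto
    hence "card {j. j < n \<and> ?y j \<noteq> x j} < card {j. j < n \<and> y j \<noteq> x j}" by (intro psubset_card_mono) auto
    moreover have "(\<Sum>j<k. ?y j) \<le> (\<Sum>j<k. x j)" if "k \<le> n" for k using 2 that by (intro sum_mono) auto
    moreover have "Q ?y" using raise[OF Qy 2(1)] 2(2) by simp
    ultimately show ?thesis using less.hyps[of ?y] by blast
  next
    case 3
    \<comment> \<open>At the first excess \<open>l\<close>, the prefix sum up to and including
      \<open>l\<close> could not be bounded by that of \<open>x\<close> without a deficit before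
      \<open>l\<close>.\<close>
    define l where "l = (LEAST l. l < n \<and> x l < y l)"
    have l: "l < n" "x l < y l" unfolding l_def using LeastI[of "\<lambda>l. l < n \<and> x l < y l"] 3 by auto
    have before: "y j \<le> x j" if "j < l" for j
      using not_less_Least[of j "\<lambda>l. l < n \<and> x l < y l"] that l(1) unfolding l_def by force
    have "\<exists>i<l. y i < x i"
    proof (rule ccontr)
      assume "\<not> ?thesis"
      hence "x i \<le> y i" if "i < l" for i using that by (meson not_le)
      hence "(\<Sum>i<l. x i) \<le> (\<Sum>i<l. y i)" by (intro sum_mono) auto
      thus False using sums[of "Suc l"] l by simp
    qed
    then obtain i where i: "i < l" "y i < x i" by blast
    define \<delta> where "\<delta> = min (x i - y i) (y l - x l)"
    have \<delta>: "0 < \<delta>" "\<delta> \<le> x i - y i" "\<delta> \<le> y l - x l" unfolding \<delta>_def using i l by auto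
    let ?y = "y(i := y i + \<delta>, l := y l - \<delta>)"
    \<comment> \<open>Monotonicity gives y i + \<delta> <= x i <= x l < y l, so the new value lies
      in the range that \<open>transfer\<close> allows.\<close>
    have xil: "x i \<le> x l" using mono[of i l] i l by simp
    have "Q (y(i := y i + \<delta>, l := y i + y l - (y i + \<delta>)))"
      using i l \<delta> xil by (intro transfer[OF Qy]) auto
    hence Q: "Q ?y" by simp
    have "y i + \<delta> = x i \<or> y l - \<delta> = x l" unfolding \<delta>_def by (simp add: min_def)
    hence "\<exists>j. j < n \<and> y j \<noteq> x j \<and> ?y j = x j"
    proof
      assume "y i + \<delta> = x i"
      thus ?thesis using i l(1) by (intro exI[of _ i]) simp
    next
      assume "y l - \<delta> = x l"
      thus ?thesis using l by (intro exI[of _ l]) simp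
    qed
    moreover have "y j \<noteq> x j" if "?y j \<noteq> x j" for j
      using that i(2) l(2) by (cases "j = i"; cases "j = l") simp_all
    ultimately have "{j. j < n \<and> ?y j \<noteq> x j} \<subset> {j. j < n \<and> y j \<noteq> x j}" by blast
    hence card: "card {j. j < n \<and> ?y j \<noteq> x j} < card {j. j < n \<and> y j \<noteq> x j}" by (intro psubset_card_mono) auto
    have "(\<Sum>j<k. ?y j) \<le> (\<Sum>j<k. x j)" if k: "k \<le> n" for k
    proof -
      have "(\<Sum>j<k. ?y j) = (\<Sum>j<k. y j + (if j = i then \<delta> else 0) - (if j = l then \<delta> else 0))"
        using i by (intro sum.cong) auto
      also have "\<dots> = (\<Sum>j<k. y j) + (if i < k then \<delta> else 0) - (if l < k then \<delta> else 0)"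
        by (simp add: sum.distrib sum_subtractf)
      also have "\<dots> \<le> (\<Sum>j<k. x j)"
      \<comment> \<open>Only prefixes that contain \<open>i\<close> but not \<open>l\<close> grow.
        All their entries satisfy y j <= x j, so their slack is at least x i - y i, which is at
        least \<open>\<delta>\<close>.\<close>
      proof (cases "i < k \<and> k \<le> l")
        case True
        have "\<delta> \<le> x i - y i" by (rule \<delta>(2))
        also have "\<dots> \<le> (\<Sum>j<k. x j - y j)"
          using True before by (intro member_le_sum[of i _ "\<lambda>j. x j - y j"]) auto
        finally show ?thesis using True by (simp add: sum_subtractf)
      next
        case False
        thus ?thesis using sums[OF k] \<delta>(1) i by auto
      qed
      finally show ?thesis .
    qed
    thus ?thesis using less.hyps[OF card Q] by blast
  qed
qed

text \<open>The means of \<open>diag_double (sort y)\<close> are \<open>sort y\<close>; the moves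
  lead to \<open>sort x\<close>, and a permutation of the planes restores the order of
  \<open>x\<close>.\<close>

lemma attains_means_if_weak_supmaj:
  assumes len: "length x = n" "length y = n" and pos: "\<forall>t\<in>set y. t > 0" and maj: "weak_supmaj x y"
  shows "attains_means n (sort y) (\<lambda>j. x ! j)"
proof -
  have d: "length (sort y) = n" "\<forall>t\<in>set (sort y). t > 0" using len pos by auto
  have "attains_means n (sort y) (\<lambda>j. sort y ! j)"
    unfolding attains_means_def using diag_double_pos_def[OF d] diag_double_williamson[OF d]
    by (intro exI[of _ "diag_double (sort y)"]) (auto simp: diag_double_index[OF d(1)])
  moreover have "(\<Sum>i<k. sort y ! i) \<le> (\<Sum>i<k. sort x ! i)" if k: "k \<le> n" for k
  proof (cases "k = 0")
    case False
    hence "sum_list (take k (sort y)) \<le> sum_list (take k (sort x))"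
      using maj k len unfolding weak_supmaj_def by auto
    thus ?thesis using k len by (simp add: sum_list_take)
  qed simp
  ultimately have "\<exists>z. attains_means n (sort y) z \<and> (\<forall>i<n. z i = sort x ! i)"
    using len by (intro weak_supmaj_induct[of n "\<lambda>i. sort x ! i"])
      (auto intro: attains_means_raise attains_means_transfer sorted_nth_mono)
  then obtain z where z: "attains_means n (sort y) z" "\<And>i. i < n \<Longrightarrow> z i = sort x ! i" by blast
  obtain f where f: "bij_betw f {..<n} {..<n}" "\<And>i. i < n \<Longrightarrow> x ! i = sort x ! f i"
    using permutation_Ex_bij[of x "sort x"] len by auto
  have "f i < n" if "i < n" for i using bij_betwE[OF f(1)] that by auto
  hence "\<And>i. i < n \<Longrightarrow> z (f i) = x ! i" using f(2) z(2) by simp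
  thus ?thesis using attains_means_permute[OF z(1) f(1)] unfolding attains_means_def by simp
qed

theorem theorem3:
  fixes n :: nat
  shows "(\<forall>A. pos_def (2*n) A \<longrightarrow> weak_supmaj (Delta_c n A) (sympl_eigvals n A))
       \<and> (\<forall>x y. length x = n \<longrightarrow> length y = n \<longrightarrow> (\<forall>t \<in> set x. t > 0) \<longrightarrow>
            (\<forall>t \<in> set y. t > 0) \<longrightarrow> weak_supmaj x y \<longrightarrow>
            (\<exists>A. pos_def (2*n) A \<and> Delta_c n A = x \<and> sympl_eigvals n A = sort y))"
proof (intro conjI allI impI)
  fix A assume A: "pos_def (2*n) A"
  show "weak_supmaj (Delta_c n A) (sympl_eigvals n A)"
    by (rule williamson_weak_supmaj[OF sympl_eigvals_williamson(1)[OF A] pos_defD(1)[OF A]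
      sympl_eigvals_williamson(2)[OF A]])
next
  fix x y :: "real list"
  assume len: "length x = n" "length y = n" and "\<forall>t\<in>set y. t > 0" "weak_supmaj x y"
  then obtain A where A: "pos_def (2*n) A" "williamson n A (sort y)"
    "\<And>j. j < n \<Longrightarrow> (A $$ (j, j) + A $$ (n + j, n + j)) / 2 = x ! j"
    using attains_means_if_weak_supmaj[OF len] unfolding attains_means_def by auto
  have "Delta_c n A = x" using A(3) len by (intro nth_equalityI) auto
  moreover have "sympl_eigvals n A = sort y"
    using sympl_eigvals_eqI[OF pos_defD(1)[OF A(1)] A(2)] by simp
  ultimately show "\<exists>A. pos_def (2*n) A \<and> Delta_c n A = x \<and> sympl_eigvals n A = sort y"
    using A(1) by blast
qed

end
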